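(* Let $T>0$ and let $H\colon\mathbb{R}\times\mathbb{R}^2\to\mathbb{R}$, $H=H(t,z)$, satisfy the following. (H0) $H$ is continuously differentiable in $z$, and $F(t,z):=J\nabla_zH(t,z)$ satisfies: $F$ satisfies the Carathéodory conditions and is $T$-periodic in $t$; for every $(\bar t,\bar z)\in\mathbb{R}\times\mathbb{R}^2$ the solution of $\dot z=F(t,z)$, $z(\bar t)=\bar z$ is unique; for every $\bar t\in[0,T]$ the solution of $\dot z=F(t,z)$, $z(\bar t)=0_{\mathbb{R}^2}$ can be continued to the whole interval $[0,T]$. (H1) There exist $\mathfrak r>0$, $c>0$ and $\gamma\ge1$ such that for a.e. $t\in[0,T]$ and every $\theta\in[0,2\pi)$, $\rho\ge\mathfrak r$, $$\frac{\partial H(t,\theta,\rho)}{\partial\rho}\ge c\left|\frac{\partial H(t,\theta,\rho)}{\partial\theta}\right|^{\gamma}.$$ (H2) There exist $\mathfrak r>0$, $k\in(0,1/2)$ and $m>0$ such that for a.e. $t\in[0,T]$ and every $\theta\in[0,2\pi)$, $\rho\ge\mathfrak r$, $$0<m\le H(t,\theta,\rho)\le 2k\rho\,\frac{\partial H(t,\theta,\rho)}{\partial\rho}.$$ Then the planar Hamiltonian system $\dot z=J\nabla_zH(t,z)$ admits at least one $T$-periodic solution.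
   Context: $J=\begin{pmatrix}0&1\\-1&0\end{pmatrix}$. $H(t,\theta,\rho)$ denotes $H$ expressed in clockwise canonical polar coordinates: $H(t,\theta,\rho)=H\bigl(t,(\sqrt{2\rho}\cos\theta,-\sqrt{2\rho}\sin\theta)\bigr)$, so $|z|=\sqrt{2\rho}$. Carathéodory conditions for $F\colon\mathbb{R}\times\mathbb{R}^2\to\mathbb{R}^2$: for every $z$ the map $t\mapsto F(t,z)$ is measurable; for a.e. $t$ the map $z\mapsto F(t,z)$ is continuous; for every compact $[a,b]\times K\subset\mathbb{R}\times\mathbb{R}^2$ there is $m_K\in L^1([a,b])$ with $|F(t,z)|\le m_K(t)$ for a.e. $t\in[a,b]$ and every $z\in K$. Solutions are understood in the Carathéodory sense (absolutely continuous functions satisfying the equation a.e.). *)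

theory Defs
  imports "HOL-Analysis.Analysis"
begin

definition symplectic_J :: "real^2^2" where
  "symplectic_J = vector [vector [0, 1], vector [-1, 0]]"

text \<open>The library only has the relation \<open>GDERIV\<close>. The value below is meaningful where
  \<open>f\<close> is differentiable; \<open>C1_in_space\<close> guarantees this everywhere.\<close>

definition gradient :: "('a::real_inner \<Rightarrow> real) \<Rightarrow> 'a \<Rightarrow> 'a" where
  "gradient f z = (THE D. GDERIV f z :> D)"

definition C1_in_space :: "(real \<Rightarrow> real^2 \<Rightarrow> real) \<Rightarrow> bool" where
  "C1_in_space H \<longleftrightarrow>
     (\<forall>t. (\<forall>z. H t differentiable (at z)) \<and> continuous_on UNIV (gradient (H t)))"

definition hamiltonian_field :: "(real \<Rightarrow> real^2 \<Rightarrow> real) \<Rightarrow> real \<Rightarrow> real^2 \<Rightarrow> real^2" where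
  "hamiltonian_field H t z = symplectic_J *v gradient (H t) z"

text \<open>Clockwise canonical polar coordinates (note the minus sign), with \<open>\<rho> = (norm z)\<^sup>2 / 2\<close>.\<close>

definition polar :: "real \<Rightarrow> real \<Rightarrow> real^2" where
  "polar \<theta> \<rho> = vector [sqrt (2 * \<rho>) * cos \<theta>, - (sqrt (2 * \<rho>) * sin \<theta>)]"

definition polar_H :: "(real \<Rightarrow> real^2 \<Rightarrow> real) \<Rightarrow> real \<Rightarrow> real \<Rightarrow> real \<Rightarrow> real" where
  "polar_H H t \<theta> \<rho> = H t (polar \<theta> \<rho>)"

text \<open>Measurability and null sets are with respect to Lebesgue measure.\<close>

definition caratheodory :: "(real \<Rightarrow> real^2 \<Rightarrow> real^2) \<Rightarrow> bool" where
  "caratheodory F \<longleftrightarrow>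
     (\<forall>z. (\<lambda>t. F t z) \<in> borel_measurable lebesgue) \<and>
     (AE t in lebesgue. continuous_on UNIV (F t)) \<and>
     (\<forall>a b K. compact K \<longrightarrow>
        (\<exists>m::real \<Rightarrow> real. m absolutely_integrable_on {a..b} \<and>
           (AE t in lebesgue. t \<in> {a..b} \<longrightarrow> (\<forall>z\<in>K. norm (F t z) \<le> m t))))"

text \<open>The usual epsilon-delta definition. The pairs in \<open>D\<close> are the end points of finitely many
  pairwise non-overlapping subintervals of \<open>{a..b}\<close>. (The library constant
  \<open>absolutely_continuous\<close> is the notion for measures.)\<close>

definition abs_continuous_fun :: "real \<Rightarrow> real \<Rightarrow> (real \<Rightarrow> 'a::metric_space) \<Rightarrow> bool" where
  "abs_continuous_fun a b u \<longleftrightarrow>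
     (\<forall>\<epsilon>>0. \<exists>\<delta>>0. \<forall>D::(real \<times> real) set.
        finite D \<and> (\<forall>(x, y)\<in>D. a \<le> x \<and> x \<le> y \<and> y \<le> b) \<and>
        disjoint_family_on (\<lambda>(x, y). {x<..<y}) D \<and> (\<Sum>(x, y)\<in>D. y - x) < \<delta> \<longrightarrow>
        (\<Sum>(x, y)\<in>D. dist (u x) (u y)) < \<epsilon>)"

text \<open>A solution on an arbitrary interval \<open>I\<close> is absolutely continuous on every compact
  subinterval. Values of \<open>u\<close> outside \<open>I\<close> are irrelevant, hence the derivative within \<open>I\<close>.\<close>

definition caratheodory_solution ::
    "(real \<Rightarrow> real^2 \<Rightarrow> real^2) \<Rightarrow> real set \<Rightarrow> (real \<Rightarrow> real^2) \<Rightarrow> bool" where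
  "caratheodory_solution F I u \<longleftrightarrow>
     is_interval I \<and>
     (\<forall>a b. a \<le> b \<and> {a..b} \<subseteq> I \<longrightarrow> abs_continuous_fun a b u) \<and>
     (AE t in lebesgue. t \<in> I \<longrightarrow> (u has_vector_derivative F t (u t)) (at t within I))"

definition unique_solutions :: "(real \<Rightarrow> real^2 \<Rightarrow> real^2) \<Rightarrow> bool" where
  "unique_solutions F \<longleftrightarrow>
     (\<forall>s z I u v. s \<in> I \<and>
        caratheodory_solution F I u \<and> caratheodory_solution F I v \<and> u s = z \<and> v s = z \<longrightarrow>
        (\<forall>t\<in>I. u t = v t))"

text \<open>Every local solution through \<open>(s, z)\<close> extends to all of \<open>S\<close>. The interval \<open>I = {s}\<close> is
  allowed, so this includes the existence of a solution on \<open>S\<close>.\<close>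

definition solution_continuable ::
    "(real \<Rightarrow> real^2 \<Rightarrow> real^2) \<Rightarrow> real set \<Rightarrow> real \<Rightarrow> real^2 \<Rightarrow> bool" where
  "solution_continuable F S s z \<longleftrightarrow>
     (\<forall>I u. s \<in> I \<and> I \<subseteq> S \<and> caratheodory_solution F I u \<and> u s = z \<longrightarrow>
        (\<exists>v. caratheodory_solution F S v \<and> (\<forall>t\<in>I. v t = u t)))"

end

theory Submission
  imports Defs "HOL-Complex_Analysis.Great_Picard"
begin

text \<open>
  Let \<open>P\<close> be the time-\<open>T\<close> map. By (H1), changing \<open>\<rho> = (norm z)\<^sup>2 / 2\<close> costs clockwise rotation, and by
  (H2) the angular speed is unbounded at infinity; hence a solution that avoids a fixed neighbourhood
  of the origin and rotates by at most \<open>C\<close> stays in a ball depending only on \<open>C\<close>. Solutions that do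
  meet a small disc of radius \<open>\<delta>\<close> stay in another fixed ball, since the solutions through \<open>0\<close> exist on
  \<open>[0,T]\<close> and depend continuously on compact data. Measure rotation by the integral of the angular
  speed, regularised in that disc, and let \<open>U\<close> be the set of initial values whose solutions exist on
  \<open>[0,T]\<close> and rotate by less than \<open>(2N+1)\<pi>\<close>. For large \<open>N\<close> it is a bounded open neighbourhood of \<open>0\<close>,
  and on its boundary the rotation is exactly \<open>(2N+1)\<pi>\<close>, so that \<open>P z\<close> is a negative multiple of \<open>z\<close>.
  The Poincare--Bohl theorem yields a fixed point of \<open>P\<close>.
\<close>

text \<open>Nothing excludes blow-up of solutions that start far away, so the time-\<open>T\<close>
  map need not exist globally. Solutions are therefore taken for a field frozen outside a ball of
  radius \<open>R\<close>; it is dominated by an integrable function of time, but it may lack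
  uniqueness and says something about the original system only inside the ball. Hence the order of
  the constants: the disc, and the radius \<open>R1\<close> of a ball that holds every solution
  meeting it; then \<open>N\<close>, such that the rotation possible in that ball stays below
  \<open>(2N+1)\<pi>\<close>; then the a priori bound \<open>M\<close> for this rotation, which must
  not depend on \<open>R\<close>; finally \<open>R = max R1 M\<close>. With this choice the
  constraint on the norm is never active on the boundary of \<open>U\<close>, and boundary solutions
  avoid the disc, where the regularised rotation would not be an angle. Constructed solutions
  satisfy the integral equation. Only its passage to the almost everywhere form is proved: solutions
  supplied by hypotheses are compared with constructed ones through uniqueness.\<close>

section \<open>Indefinite integrals and absolute continuity\<close>

text \<open>The intervals on which the difference quotient is bad are tagged at one of their end points, so
  Henstock's lemma bounds the total length of disjoint ones, and a Vitali cover passes to all of them.\<close>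

lemma negligible_not_differentiable_indefinite_integral:
  fixes f :: "real \<Rightarrow> 'a::euclidean_space"
  assumes f: "f integrable_on {a..b}"
  shows "negligible {x \<in> {a<..<b}. \<not> ((\<lambda>t. integral {a..t} f) has_vector_derivative f x) (at x)}"
proof -
  define F where "F = (\<lambda>t. integral {a..t} f)"
  define bad where "bad e x y \<longleftrightarrow> y \<in> {a<..<b} \<and> y \<noteq> x \<and> norm (F y - F x - (y - x) *\<^sub>R f x) > e * \<bar>y - x\<bar>"
    for e x y
  define B where "B e = {x \<in> {a<..<b}. \<forall>d>0. \<exists>y. \<bar>y - x\<bar> < d \<and> bad e x y}" for e
  have diff: "F v - F u = integral {u..v} f" if "a \<le> u" "u \<le> v" "v \<le> b" for u v
  proof -
    have "f integrable_on {a..v}" using f that by (auto intro: integrable_on_subinterval)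
    from Henstock_Kurzweil_Integration.integral_combine[OF that(1,2) this] show ?thesis by (simp add: F_def algebra_simps)
  qed
  have neg: "negligible (B e)" if e: "e > 0" for e
    unfolding negligible_outer_le
  proof (intro allI impI)
    fix \<epsilon> :: real assume "\<epsilon> > 0"
    \<comment> \<open>The tolerance anticipates two losses: a factor \<open>5\<close> from enlarging
      the Vitali balls and a factor \<open>1 / e\<close> from the badness of each interval.\<close>
    then have e': "\<epsilon> * e / 5 > 0" using e by simp
    have f': "f integrable_on cbox a b" using f by simp
    obtain \<gamma> where g: "gauge \<gamma>" and H: "\<And>p. \<lbrakk>p tagged_partial_division_of (cbox a b); \<gamma> fine p\<rbrakk> \<Longrightarrow>
             sum (\<lambda>(x,k). norm(measure lborel k *\<^sub>R f x - integral k f)) p < \<epsilon> * e / 5"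
      by (rule Henstock_lemma[OF f' e']) blast
    \<comment> \<open>Members pair a tag with the other end point, close enough for the gauge: any
      finite disjoint selection is then a fine tagged partial division.\<close>
    define I where "I = {(x, y). x \<in> B e \<and> bad e x y \<and> {min x y..max x y} \<subseteq> \<gamma> x}"
    define c where "c = (\<lambda>(x, y). (x + y) / 2 :: real)"
    define r where "r = (\<lambda>(x, y). \<bar>y - x\<bar> / 2 :: real)"
    have cb: "cball (c (x, y)) (r (x, y)) = {min x y..max x y}" for x y
      by (auto simp: c_def r_def cball_eq_atLeastAtMost min_def max_def abs_if field_simps)
    have inI: "x \<in> {a<..<b} \<and> y \<in> {a<..<b} \<and> x \<noteq> y" if "(x, y) \<in> I" for x y
      using that by (auto simp: I_def B_def bad_def)
    have cov: "B e \<subseteq> (\<Union>i\<in>I. cball (c i) (r i))"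
    proof
      fix x assume x: "x \<in> B e"
      have "open (\<gamma> x)" "x \<in> \<gamma> x" using g by (auto simp: gauge_def)
      then obtain d where d: "d > 0" "ball x d \<subseteq> \<gamma> x" using openE by blast
      then obtain y where y: "\<bar>y - x\<bar> < d" "bad e x y" using x by (auto simp: B_def)
      have "{min x y..max x y} \<subseteq> ball x d" using y d by (auto simp: ball_def dist_real_def min_def max_def)
      then have "(x, y) \<in> I" using x y d by (auto simp: I_def)
      moreover have "x \<in> cball (c (x, y)) (r (x, y))" unfolding cb by auto
      ultimately show "x \<in> (\<Union>i\<in>I. cball (c i) (r i))" by blast
    qed
    have "0 < r i \<and> r i \<le> (b - a) / 2" if "i \<in> I" for i
      using inI[of "fst i" "snd i"] that by (auto simp: r_def split_beta)
    from Vitali_covering_lemma_cballs[OF cov this] obtain C where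
      C: "countable C" "C \<subseteq> I" "pairwise (\<lambda>i j. disjnt (cball (c i) (r i)) (cball (c j) (r j))) C"
       "B e \<subseteq> (\<Union>i\<in>C. cball (c i) (5 * r i))" .
    have rpos: "r i > 0" if "i \<in> C" for i
      using inI[of "fst i" "snd i"] that C by (auto simp: r_def split_beta)
    \<comment> \<open>Henstock's lemma speaks of finite divisions, so the bound is shown for finite
      subfamilies; being uniform, it passes to the countable union.\<close>
    have fin: "measure lebesgue (\<Union>i\<in>C'. cball (c i) (5 * r i)) \<le> \<epsilon>" if C': "C' \<subseteq> C" "finite C'" for C'
    proof -
      define K where "K i = cball (c i) (r i)" for i
      have K: "K i = {min (fst i) (snd i)..max (fst i) (snd i)}" for i
        using cb[of "fst i" "snd i"] by (simp add: K_def)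
      define p where "p = (\<lambda>i. (fst i, K i)) ` C'"
      have dis: "K i \<inter> K j = {}" if "i \<in> C'" "j \<in> C'" "i \<noteq> j" for i j
        using C(3) C' that by (auto simp: pairwise_def disjnt_def K_def)
      have fstK: "fst i \<in> K i" for i by (auto simp: K)
      have inj: "inj_on (\<lambda>i. (fst i, K i)) C'"
        using dis fstK by (fastforce simp: inj_on_def)
      have "p tagged_partial_division_of (cbox a b)"
        unfolding tagged_partial_division_of_def
      proof (intro conjI allI impI)
        show "finite p" using C' by (simp add: p_def)
        fix x L assume "(x, L) \<in> p"
        then obtain i where i: "i \<in> C'" "x = fst i" "L = K i" by (auto simp: p_def)
        show "x \<in> L" using i fstK by simp
        show "L \<subseteq> cbox a b" using i inI[of "fst i" "snd i"] C C' by (auto simp: K)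
        show "\<exists>a b. L = cbox a b" using i K by auto
      next
        fix x1 k1 x2 k2 assume "(x1, k1) \<in> p \<and> (x2, k2) \<in> p \<and> (x1, k1) \<noteq> (x2, k2)"
        then show "interior k1 \<inter> interior k2 = {}"
          using dis interior_subset unfolding p_def by blast
      qed
      moreover have "\<gamma> fine p"
        unfolding fine_def p_def using C' C(2) by (fastforce simp: I_def K)
      ultimately have sm: "sum (\<lambda>(x,k). norm(measure lborel k *\<^sub>R f x - integral k f)) p < \<epsilon> * e / 5" by (rule H)
      have each: "e * (2 * r i) \<le> norm (measure lborel (K i) *\<^sub>R f (fst i) - integral (K i) f)" if "i \<in> C'" for i
      proof -
        obtain x y where xy: "i = (x, y)" by fastforce
        have "bad e x y" and I: "(x, y) \<in> I" using that C' C xy by (auto simp: I_def)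
        then have b: "norm (F y - F x - (y - x) *\<^sub>R f x) > e * \<bar>y - x\<bar>" by (simp add: bad_def)
        note ab = inI[OF I]
        show ?thesis
        proof (cases "x \<le> y")
          case True
          then have "integral (K i) f = F y - F x" using diff[of x y] ab by (simp add: K xy)
          moreover have "measure lborel (K i) = y - x" using True by (simp add: K xy)
          moreover have "2 * r i = \<bar>y - x\<bar>" by (simp add: xy r_def)
          ultimately show ?thesis using b by (simp add: xy norm_minus_commute del: mult_cancel_left)
        next
          case False
          then have 1: "integral (K i) f = F x - F y" using diff[of y x] ab by (simp add: K xy)
          have "measure lborel (K i) *\<^sub>R f x - integral (K i) f = F y - F x - (y - x) *\<^sub>R f x"
            unfolding 1 using False by (simp add: K xy algebra_simps)
          moreover have "2 * r i = \<bar>y - x\<bar>" by (simp add: xy r_def)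
          ultimately show ?thesis using b unfolding xy fst_conv by (simp only:)
        qed
      qed
      have "measure lebesgue (\<Union>i\<in>C'. cball (c i) (5 * r i)) \<le> (\<Sum>i\<in>C'. measure lebesgue (cball (c i) (5 * r i)))"
        using C' by (intro measure_UNION_le) auto
      also have "\<dots> = (\<Sum>i\<in>C'. 10 * r i)"
        using rpos C' by (intro sum.cong) (auto simp: cball_eq_atLeastAtMost subset_iff less_imp_le)
      also have "\<dots> = (5 / e) * (\<Sum>i\<in>C'. e * (2 * r i))"
        using e by (simp add: sum_distrib_left)
      also have "\<dots> \<le> (5 / e) * (\<Sum>i\<in>C'. norm (measure lborel (K i) *\<^sub>R f (fst i) - integral (K i) f))"
        using e each by (intro mult_left_mono sum_mono) auto
      also have "(\<Sum>i\<in>C'. norm (measure lborel (K i) *\<^sub>R f (fst i) - integral (K i) f)) = sum (\<lambda>(x,k). norm(measure lborel k *\<^sub>R f x - integral k f)) p"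
        unfolding p_def by (subst sum.reindex[OF inj]) (simp add: o_def)
      also have "(5 / e) * \<dots> \<le> (5 / e) * (\<epsilon> * e / 5)"
        using sm e by (intro mult_left_mono) auto
      also have "\<dots> = \<epsilon>" using e by simp
      finally show ?thesis .
    qed
    show "\<exists>T. B e \<subseteq> T \<and> T \<in> lmeasurable \<and> measure lebesgue T \<le> \<epsilon>"
    proof (intro exI conjI)
      show "B e \<subseteq> (\<Union>i\<in>C. cball (c i) (5 * r i))" by (fact C)
      show "(\<Union>i\<in>C. cball (c i) (5 * r i)) \<in> lmeasurable"
        by (rule fmeasurable_UN_bound[OF C(1) _ fin]) auto
      show "measure lebesgue (\<Union>i\<in>C. cball (c i) (5 * r i)) \<le> \<epsilon>"
        by (rule measure_UN_bound[OF C(1) _ fin]) auto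
    qed
  qed
  have "negligible (\<Union>n. B (1 / Suc n))"
    by (intro negligible_Union_nat neg) simp
  moreover have "{x \<in> {a<..<b}. \<not> (F has_vector_derivative f x) (at x)} \<subseteq> (\<Union>n. B (1 / Suc n))"
  proof
    fix x assume x: "x \<in> {x \<in> {a<..<b}. \<not> (F has_vector_derivative f x) (at x)}"
    show "x \<in> (\<Union>n. B (1 / Suc n))"
    proof (rule ccontr)
      assume n: "x \<notin> (\<Union>n. B (1 / Suc n))"
      have "(F has_derivative (\<lambda>h. h *\<^sub>R f x)) (at x)"
        unfolding has_derivative_at_alt
      proof (intro conjI allI impI)
        show "bounded_linear (\<lambda>h. h *\<^sub>R f x)" by (rule bounded_linear_scaleR_left)
        fix e :: real assume "e > 0"
        then obtain n where n': "1 / Suc n < e" using reals_Archimedean by (auto simp: inverse_eq_divide)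
        from n have "x \<notin> B (1 / Suc n)" by blast
        then obtain d where d: "d > 0" "\<And>y. \<bar>y - x\<bar> < d \<Longrightarrow> \<not> bad (1 / Suc n) x y"
          using x by (auto simp: B_def)
        \<comment> \<open>Shrunk to keep \<open>y\<close> in \<open>{a<..<b}\<close>: elsewhere the
          negation of \<open>bad\<close> carries no information.\<close>
        define d' where "d' = min d (min (x - a) (b - x))"
        show "\<exists>d>0. \<forall>y. norm (y - x) < d \<longrightarrow> norm (F y - F x - (y - x) *\<^sub>R f x) \<le> e * norm (y - x)"
        proof (intro exI conjI allI impI)
          show "d' > 0" using d x by (auto simp: d'_def)
          fix y assume y: "norm (y - x) < d'"
          then have "\<not> bad (1 / Suc n) x y" "y \<in> {a<..<b}" using d by (auto simp: d'_def abs_if split: if_splits)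
          then have "norm (F y - F x - (y - x) *\<^sub>R f x) \<le> 1 / Suc n * \<bar>y - x\<bar>"
            by (cases "y = x") (auto simp: bad_def)
          also have "\<dots> \<le> e * \<bar>y - x\<bar>" using n' by (intro mult_right_mono) auto
          finally show "norm (F y - F x - (y - x) *\<^sub>R f x) \<le> e * norm (y - x)" by simp
        qed
      qed
      then show False using x by (simp add: has_vector_derivative_def)
    qed
  qed
  ultimately show ?thesis unfolding F_def by (rule negligible_subset)
qed

text \<open>The exceptional set is harmless because the majorant can be put to \<open>0\<close> there: Henstock's lemma for
  the modified majorant then bounds the increments of \<open>u\<close> over intervals tagged in that set.\<close>

lemma fundamental_theorem_of_calculus_AE:
  fixes u :: "real \<Rightarrow> 'a::euclidean_space"
  assumes ab: "a \<le> b" and m: "m integrable_on {a..b}"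
    and dom: "\<And>x y. a \<le> x \<Longrightarrow> x \<le> y \<Longrightarrow> y \<le> b \<Longrightarrow> norm (u y - u x) \<le> integral {x..y} m"
    and N: "negligible N"
    and der: "\<And>t. t \<in> {a<..<b} \<Longrightarrow> t \<notin> N \<Longrightarrow> (u has_vector_derivative f t) (at t)"
  shows "(f has_integral (u b - u a)) {a..b}"
proof -
  define M where "M = N \<union> {a, b}"
  have M: "negligible M" using N by (simp add: M_def negligible_insert negligible_Un)
  define f0 where "f0 t = (if t \<in> M then 0 else f t)" for t
  define m0 where "m0 t = (if t \<in> M then 0 else m t)" for t
  have m0: "m0 integrable_on cbox a b"
    using integrable_spike[OF m M, of m0] by (simp add: m0_def)
  have m0i: "integral {x..y} m0 = integral {x..y} m" for x y
    by (rule integral_spike[OF M]) (auto simp: m0_def)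
  have "(f0 has_integral (u b - u a)) {a..b}"
    unfolding has_integral_real
  proof (intro allI impI)
    fix e :: real assume e: "e > 0"
    then have e2: "e / 2 > 0" by simp
    obtain \<gamma> where g: "gauge \<gamma>" and H: "\<And>p. \<lbrakk>p tagged_partial_division_of (cbox a b); \<gamma> fine p\<rbrakk> \<Longrightarrow>
             sum (\<lambda>(x,k). norm(measure lborel k *\<^sub>R m0 x - integral k m0)) p < e / 2"
      by (rule Henstock_lemma[OF m0 e2]) blast
    define e' where "e' = e / (2 * (b - a + 1))"
    have e': "e' > 0" using e ab by (simp add: e'_def)
    have "\<exists>d>0. \<forall>y. \<bar>y - x\<bar> < d \<longrightarrow> norm (u y - u x - (y - x) *\<^sub>R f x) \<le> e' * \<bar>y - x\<bar>"
      if "x \<in> {a..b} - M" for x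
    proof -
      have "(u has_vector_derivative f x) (at x)" using that by (intro der) (auto simp: M_def)
      then show ?thesis using e' by (simp add: has_vector_derivative_def has_derivative_at_alt)
    qed
    then obtain d where d: "\<And>x. x \<in> {a..b} - M \<Longrightarrow> d x > 0"
      "\<And>x y. x \<in> {a..b} - M \<Longrightarrow> \<bar>y - x\<bar> < d x \<Longrightarrow> norm (u y - u x - (y - x) *\<^sub>R f x) \<le> e' * \<bar>y - x\<bar>"
      by metis
    define \<gamma>' where "\<gamma>' x = (if x \<in> {a..b} - M then \<gamma> x \<inter> ball x (d x) else \<gamma> x)" for x
    show "\<exists>\<gamma>. gauge \<gamma> \<and> (\<forall>p. p tagged_division_of {a..b} \<and> \<gamma> fine p \<longrightarrow>
        norm ((\<Sum>(x, k)\<in>p. measure lborel k *\<^sub>R f0 x) - (u b - u a)) < e)"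
    proof (intro exI conjI allI impI)
      show "gauge \<gamma>'" using g d by (auto simp: gauge_def \<gamma>'_def)
      fix p assume p: "p tagged_division_of {a..b} \<and> \<gamma>' fine p"
      then have ptd: "p tagged_division_of {a..b}" by simp
      have fp: "\<gamma> fine p" using p unfolding fine_def \<gamma>'_def by (fastforce split: if_splits)
      have ptp: "p tagged_partial_division_of (cbox a b)" using ptd by (simp add: tagged_division_of_def)
      have telescoping: "(\<Sum>(x, k)\<in>p. u (Sup k) - u (Inf k)) = u b - u a"
        by (rule additive_tagged_division_1[OF ab ptd])
      have each: "norm (measure lborel k *\<^sub>R f0 x - (u (Sup k) - u (Inf k)))
          \<le> norm (measure lborel k *\<^sub>R m0 x - integral k m0) + e' * measure lborel k" if xk: "(x, k) \<in> p" for x k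
      proof -
        obtain v w where k: "k = {v..w}" using tagged_division_ofD(4)[OF ptd xk] by auto
        have xin: "x \<in> k" using tagged_division_ofD(2)[OF ptd xk] .
        have sub: "k \<subseteq> {a..b}" using tagged_division_ofD(3)[OF ptd xk] .
        have vw: "v \<le> x" "x \<le> w" "a \<le> v" "w \<le> b" using xin sub k by auto
        show ?thesis
        proof (cases "x \<in> M")
          case True
          \<comment> \<open>At a tag in \<open>M\<close> both \<open>f0\<close> and
            \<open>m0\<close> vanish, so the Henstock error of \<open>m0\<close> is the absolute
            value of its integral, and this dominates the increment of \<open>u\<close>.\<close>
          have "norm (u w - u v) \<le> integral {v..w} m0" using dom vw by (simp add: m0i)
          moreover have "e' * (w - v) \<ge> 0" using e' vw by simp
          ultimately show ?thesis using True vw by (auto simp: k f0_def m0_def norm_minus_commute[of "u v"])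
        next
          case False
          then have xM: "x \<in> {a..b} - M" using vw by auto
          have kb: "k \<subseteq> ball x (d x)" using p xk xM by (fastforce simp: fine_def \<gamma>'_def)
          have "v \<in> k" "w \<in> k" using vw k by auto
          then have "v \<in> ball x (d x)" "w \<in> ball x (d x)" using kb by blast+
          then have "\<bar>v - x\<bar> < d x" "\<bar>w - x\<bar> < d x" by (auto simp: dist_real_def)
          then have 1: "norm (u v - u x - (v - x) *\<^sub>R f x) \<le> e' * (x - v)"
              and 2: "norm (u w - u x - (w - x) *\<^sub>R f x) \<le> e' * (w - x)"
            using d(2)[OF xM, of v] d(2)[OF xM, of w] vw by auto
          \<comment> \<open>The tag lies in the interval, so the increment is split there and the
            differentiability estimate is used on both sides.\<close>
          have "norm (measure lborel k *\<^sub>R f0 x - (u w - u v))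
            = norm ((u v - u x - (v - x) *\<^sub>R f x) - (u w - u x - (w - x) *\<^sub>R f x))"
            using vw False by (simp add: k f0_def algebra_simps)
          also have "\<dots> \<le> e' * (x - v) + e' * (w - x)"
            by (rule order_trans[OF norm_triangle_ineq4 add_mono[OF 1 2]])
          also have "\<dots> = e' * measure lborel k" using vw by (simp add: k algebra_simps)
          finally have "norm (measure lborel k *\<^sub>R f0 x - (u w - u v)) \<le> e' * measure lborel k" .
          moreover have "Sup k = w" "Inf k = v" using vw by (auto simp: k)
          ultimately show ?thesis by (smt (verit) norm_ge_zero)
        qed
      qed
      have cs: "(\<Sum>(x, k)\<in>p. measure lborel k) = b - a"
        using additive_content_tagged_division[of p a b] ptd ab by simp
      have "norm ((\<Sum>(x, k)\<in>p. measure lborel k *\<^sub>R f0 x) - (u b - u a))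
        = norm (\<Sum>(x, k)\<in>p. measure lborel k *\<^sub>R f0 x - (u (Sup k) - u (Inf k)))"
        unfolding telescoping[symmetric] by (simp add: sum_subtractf split_beta)
      also have "\<dots> \<le> (\<Sum>(x, k)\<in>p. norm (measure lborel k *\<^sub>R m0 x - integral k m0) + e' * measure lborel k)"
        by (rule sum_norm_le) (use each in auto)
      also have "\<dots> = (\<Sum>(x, k)\<in>p. norm (measure lborel k *\<^sub>R m0 x - integral k m0)) + e' * (b - a)"
        unfolding cs[symmetric] by (simp add: sum.distrib split_beta sum_distrib_left)
      also have "\<dots> < e / 2 + e / 2"
      proof (rule add_less_le_mono)
        show "(\<Sum>(x, k)\<in>p. norm (measure lborel k *\<^sub>R m0 x - integral k m0)) < e / 2" by (rule H[OF ptp fp])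
        show "e' * (b - a) \<le> e / 2" using e ab by (simp add: e'_def field_simps)
      qed
      finally show "norm ((\<Sum>(x, k)\<in>p. measure lborel k *\<^sub>R f0 x) - (u b - u a)) < e" by simp
    qed
  qed
  then show ?thesis
    by (rule has_integral_spike[OF M, rotated]) (auto simp: f0_def)
qed

text \<open>The domination by an integral excludes functions like Cantor's, which are not constant
  although their derivative vanishes almost everywhere.\<close>

lemma has_vector_derivative_zero_AE_imp_eq:
  fixes u :: "real \<Rightarrow> 'a::euclidean_space"
  assumes "a \<le> b" "m integrable_on {a..b}"
    and "\<And>x y. a \<le> x \<Longrightarrow> x \<le> y \<Longrightarrow> y \<le> b \<Longrightarrow> norm (u y - u x) \<le> integral {x..y} m"
    and "negligible N"
    and "\<And>t. t \<in> {a<..<b} \<Longrightarrow> t \<notin> N \<Longrightarrow> (u has_vector_derivative 0) (at t)"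
  shows "u b = u a"
  using fundamental_theorem_of_calculus_AE[OF assms(1-4), of "\<lambda>_. 0"] assms(5) has_integral_unique[OF has_integral_0]
  by (metis eq_iff_diff_eq_0)

lemma sum_integral_nonoverlapping_le:
  fixes h :: "real \<Rightarrow> real"
  assumes h: "h integrable_on {a..b}" "\<And>t. t \<in> {a..b} \<Longrightarrow> 0 \<le> h t"
    and D: "finite D" "\<forall>(x, y)\<in>D. a \<le> x \<and> x \<le> y \<and> y \<le> b"
      "disjoint_family_on (\<lambda>(x, y). {x<..<y}) D"
  shows "(\<Sum>(x, y)\<in>D. integral {x..y} h) \<le> integral {a..b} h"
proof -
  \<comment> \<open>Open intervals are used because the closed ones may share end points: at each
    time at most one summand is then nonzero.\<close>
  define g where "g p t = (if t \<in> {fst p<..<snd p} then h t else 0)" for p t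
  have g: "(g p has_integral integral {fst p..snd p} h) {a..b}" if "p \<in> D" for p
  proof -
    have sub: "{fst p<..<snd p} \<inter> {a..b} = {fst p<..<snd p}" using that D(2) by fastforce
    have "h integrable_on {fst p..snd p}" using h(1) that D(2)
      by (intro integrable_on_subinterval[OF h(1)]) fastforce
    then have "(h has_integral integral {fst p..snd p} h) {fst p..snd p}" by (rule integrable_integral)
    then have "(h has_integral integral {fst p..snd p} h) {fst p<..<snd p}"
      using has_integral_open_interval[of h _ "fst p" "snd p"] by simp
    then show ?thesis
      unfolding g_def using has_integral_restrict_Int[of "{fst p<..<snd p}" h _ "{a..b}"] sub by simp
  qed
  have "(\<Sum>(x, y)\<in>D. integral {x..y} h) = (\<Sum>p\<in>D. integral {fst p..snd p} h)"
    by (simp add: split_beta)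
  also have "\<dots> \<le> integral {a..b} h"
  proof (rule has_integral_le[OF has_integral_sum[OF D(1) g] integrable_integral[OF h(1)]])
    fix t assume t: "t \<in> {a..b}"
    show "(\<Sum>p\<in>D. g p t) \<le> h t"
    proof (cases "\<exists>p\<in>D. t \<in> {fst p<..<snd p}")
      case True
      then obtain p where p: "p \<in> D" "t \<in> {fst p<..<snd p}" by blast
      have "g q t = 0" if "q \<in> D - {p}" for q
      proof -
        have "{fst q<..<snd q} \<inter> {fst p<..<snd p} = {}"
          using D(3) p that unfolding disjoint_family_on_def by (auto simp: split_beta)
        then show ?thesis using p by (auto simp: g_def)
      qed
      then have "(\<Sum>q\<in>D. g q t) = g p t" using D(1) p
        by (subst sum.remove[of _ p]) (auto intro!: sum.neutral)
      then show ?thesis using p by (simp add: g_def)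
    next
      case False
      then show ?thesis using h(2)[OF t] by (auto simp: g_def intro!: order_trans[OF eq_refl[OF sum.neutral]])
    qed
  qed
  finally show ?thesis .
qed

text \<open>The majorant is split into \<open>min (m t) (real n)\<close>, whose integrals are at
  most \<open>n\<close> times the total length, and the excess \<open>h n\<close>, whose whole
  integral is small for large \<open>n\<close> by dominated convergence.\<close>

lemma abs_continuous_fun_integral_bound:
  fixes u :: "real \<Rightarrow> 'a::euclidean_space"
  assumes m: "m absolutely_integrable_on {a..b}" and nonneg: "\<And>t. t \<in> {a..b} \<Longrightarrow> 0 \<le> (m t :: real)"
    and dom: "\<And>x y. a \<le> x \<Longrightarrow> x \<le> y \<Longrightarrow> y \<le> b \<Longrightarrow> norm (u y - u x) \<le> integral {x..y} m"
  shows "abs_continuous_fun a b u"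
  unfolding abs_continuous_fun_def
proof (intro allI impI)
  fix e :: real assume e: "e > 0"
  have mi: "m integrable_on {a..b}" using m by (simp add: absolutely_integrable_on_def)
  define h where "h n t = m t - min (m t) (real n)" for n t
  have minai: "(\<lambda>t. min (m t) (real n)) absolutely_integrable_on {a..b}" for n
    by (rule absolutely_integrable_min_1[OF m]) simp
  then have mini: "(\<lambda>t. min (m t) (real n)) integrable_on {a..b}" for n
    by (simp add: absolutely_integrable_on_def)
  have hi: "h n integrable_on {a..b}" for n
    unfolding h_def by (rule integrable_diff[OF mi mini])
  have "(\<lambda>n. integral {a..b} (h n)) \<longlonglongrightarrow> integral {a..b} (\<lambda>t. 0)"
  proof (rule dominated_convergence(2)[OF hi mi])
    show "norm (h n t) \<le> m t" if "t \<in> {a..b}" for n t using nonneg[OF that] by (auto simp: h_def min_def)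
    show "(\<lambda>n. h n t) \<longlonglongrightarrow> 0" if "t \<in> {a..b}" for t
    proof (rule tendsto_eventually)
      obtain n0 where "m t \<le> real n0" using real_arch_simple by blast
      then show "\<forall>\<^sub>F n in sequentially. h n t = 0"
        by (intro eventually_sequentiallyI[of n0]) (auto simp: h_def)
    qed
  qed
  then have "(\<lambda>n. integral {a..b} (h n)) \<longlonglongrightarrow> 0" by simp
  from order_tendstoD(2)[OF this, of "e / 2"] e obtain n where n: "integral {a..b} (h n) < e / 2"
    by (auto simp: eventually_sequentially)
  define \<delta> where "\<delta> = e / (2 * (real n + 1))"
  show "\<exists>\<delta>>0. \<forall>D. finite D \<and> (\<forall>(x, y)\<in>D. a \<le> x \<and> x \<le> y \<and> y \<le> b) \<and>
        disjoint_family_on (\<lambda>(x, y). {x<..<y}) D \<and> (\<Sum>(x, y)\<in>D. y - x) < \<delta> \<longrightarrow>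
        (\<Sum>(x, y)\<in>D. dist (u x) (u y)) < e"
  proof (intro exI conjI allI impI; (elim conjE)?)
    show "\<delta> > 0" using e by (simp add: \<delta>_def)
    fix D assume D: "finite D" "\<forall>(x, y)\<in>D. a \<le> x \<and> x \<le> y \<and> y \<le> b"
        "disjoint_family_on (\<lambda>(x, y). {x<..<y}) D" and sm: "(\<Sum>(x, y)\<in>D. y - x) < \<delta>"
    have each: "dist (u x) (u y) \<le> real n * (y - x) + integral {x..y} (h n)" if "(x, y) \<in> D" for x y
    proof -
      have xy: "a \<le> x" "x \<le> y" "y \<le> b" using D(2) that by auto
      then have sub: "{x..y} \<subseteq> {a..b}" by auto
      have i1: "(\<lambda>t. min (m t) (real n)) integrable_on {x..y}" and i2: "h n integrable_on {x..y}"
        using integrable_on_subinterval[OF mini sub] integrable_on_subinterval[OF hi sub] by auto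
      have "dist (u x) (u y) \<le> integral {x..y} m" using dom[OF xy] by (simp add: dist_norm norm_minus_commute)
      also have "\<dots> = integral {x..y} (\<lambda>t. min (m t) (real n) + h n t)" by (simp add: h_def)
      also have "\<dots> = integral {x..y} (\<lambda>t. min (m t) (real n)) + integral {x..y} (h n)"
        by (rule Henstock_Kurzweil_Integration.integral_add[OF i1 i2])
      also have "integral {x..y} (\<lambda>t. min (m t) (real n)) \<le> integral {x..y} (\<lambda>t. real n)"
        by (rule integral_le[OF i1]) auto
      also have "\<dots> = real n * (y - x)" using xy by simp
      finally show ?thesis by simp
    qed
    have "(\<Sum>(x, y)\<in>D. dist (u x) (u y)) \<le> (\<Sum>(x, y)\<in>D. real n * (y - x) + integral {x..y} (h n))"
      by (rule sum_mono) (use each in auto)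
    also have "\<dots> = real n * (\<Sum>(x, y)\<in>D. y - x) + (\<Sum>(x, y)\<in>D. integral {x..y} (h n))"
      by (simp add: sum.distrib split_beta sum_distrib_left)
    also have "(\<Sum>(x, y)\<in>D. integral {x..y} (h n)) \<le> integral {a..b} (h n)"
      by (rule sum_integral_nonoverlapping_le[OF hi _ D]) (auto simp: h_def)
    also have "real n * (\<Sum>(x, y)\<in>D. y - x) \<le> real n * \<delta>" using sm by (intro mult_left_mono) auto
    also have "real n * \<delta> \<le> e / 2" using e by (simp add: \<delta>_def field_simps)
    finally show "(\<Sum>(x, y)\<in>D. dist (u x) (u y)) < e" using n by simp
  qed
qed

section \<open>Existence and compactness of solutions\<close>

text \<open>A simple function takes finitely many values, so the composition with it is glued from
  measurable pieces; continuity in the state carries this to the pointwise limit.\<close>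

lemma borel_measurable_caratheodory_compose:
  fixes G :: "'s \<Rightarrow> 'a::{metric_space,second_countable_topology} \<Rightarrow> 'b::metric_space"
  assumes meas: "\<And>z. (\<lambda>t. G t z) \<in> borel_measurable M"
    and cont: "\<And>t. continuous_on UNIV (G t)"
    and u: "u \<in> borel_measurable M"
  shows "(\<lambda>t. G t (u t)) \<in> borel_measurable M"
proof -
  obtain s where s: "\<And>i. simple_function M (s i)" "\<And>t. t \<in> space M \<Longrightarrow> (\<lambda>i. s i t) \<longlonglongrightarrow> u t"
    using borel_measurable_implies_sequence_metric[OF u] by metis
  have "(\<lambda>t. G t (s i t)) \<in> borel_measurable M" for i
  proof (rule measurable_compose_countable'[where f = "\<lambda>z t. G t z" and I = "s i ` space M"])
    show "s i \<in> measurable M (count_space (s i ` space M))"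
      using s(1) by (simp add: measurable_simple_function simple_function_def measurable_def)
        (meson simple_functionD(2) s(1) sets.Int_space_eq2 simple_function_def)
    show "countable (s i ` space M)" using s(1) by (simp add: simple_functionD countable_finite)
  qed (rule meas)
  then show ?thesis
  proof (rule borel_measurable_LIMSEQ_metric)
    fix t assume "t \<in> space M"
    then show "(\<lambda>i. G t (s i t)) \<longlonglongrightarrow> G t (u t)"
      by (intro continuous_on_tendsto_compose[OF cont[of t]] s(2)) auto
  qed
qed

text \<open>This form survives limits by dominated convergence, which derivatives almost everywhere
  do not. The integral is the gauge integral, so absolute integrability appears as a separate
  assumption where absolute continuity is concluded.\<close>

definition integral_solution :: "(real \<Rightarrow> 'a \<Rightarrow> 'a::euclidean_space) \<Rightarrow> real \<Rightarrow> real \<Rightarrow> (real \<Rightarrow> 'a) \<Rightarrow> bool"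
  where "integral_solution F a b u \<longleftrightarrow>
    (\<forall>x y. a \<le> x \<and> x \<le> y \<and> y \<le> b \<longrightarrow> ((\<lambda>t. F t (u t)) has_integral (u y - u x)) {x..y})"

lemma integral_solutionD:
  "integral_solution F a b u \<Longrightarrow> a \<le> x \<Longrightarrow> x \<le> y \<Longrightarrow> y \<le> b \<Longrightarrow>
    ((\<lambda>t. F t (u t)) has_integral (u y - u x)) {x..y}"
  by (simp add: integral_solution_def)

lemma abs_continuous_fun_subinterval:
  assumes "abs_continuous_fun a b u" "a \<le> x" "y \<le> b"
  shows "abs_continuous_fun x y u"
  unfolding abs_continuous_fun_def
proof (intro allI impI)
  fix e :: real assume "e > 0"
  then obtain d where d: "d > 0" "\<And>D::(real \<times> real) set.
        finite D \<and> (\<forall>(x, y)\<in>D. a \<le> x \<and> x \<le> y \<and> y \<le> b) \<and>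
        disjoint_family_on (\<lambda>(x, y). {x<..<y}) D \<and> (\<Sum>(x, y)\<in>D. y - x) < d \<Longrightarrow>
        (\<Sum>(x, y)\<in>D. dist (u x) (u y)) < e"
    using assms(1) unfolding abs_continuous_fun_def by blast
  show "\<exists>d>0. \<forall>D. finite D \<and> (\<forall>(v, w)\<in>D. x \<le> v \<and> v \<le> w \<and> w \<le> y) \<and>
        disjoint_family_on (\<lambda>(x, y). {x<..<y}) D \<and> (\<Sum>(x, y)\<in>D. y - x) < d \<longrightarrow>
        (\<Sum>(x, y)\<in>D. dist (u x) (u y)) < e"
  proof (intro exI[of _ d] conjI d(1) allI impI)
    fix D :: "(real \<times> real) set"
    assume D: "finite D \<and> (\<forall>(v, w)\<in>D. x \<le> v \<and> v \<le> w \<and> w \<le> y) \<and>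
        disjoint_family_on (\<lambda>(x, y). {x<..<y}) D \<and> (\<Sum>(x, y)\<in>D. y - x) < d"
    have "\<forall>(v, w)\<in>D. x \<le> v \<and> v \<le> w \<and> w \<le> y" using D by (elim conjE)
    then have "\<forall>(v, w)\<in>D. a \<le> v \<and> v \<le> w \<and> w \<le> b" using assms(2,3) by fastforce
    then show "(\<Sum>(x, y)\<in>D. dist (u x) (u y)) < e" using D by (elim conjE, intro d(2) conjI)
  qed
qed

lemma integral_solution_imp_abs_continuous_fun:
  assumes sol: "integral_solution F a b u" and ai: "(\<lambda>t. F t (u t)) absolutely_integrable_on {a..b}"
  shows "abs_continuous_fun a b u"
proof (rule abs_continuous_fun_integral_bound)
  show "(\<lambda>t. norm (F t (u t))) absolutely_integrable_on {a..b}"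
    using absolutely_integrable_norm[OF ai] by (simp add: o_def)
  fix x y assume xy: "a \<le> x" "x \<le> y" "y \<le> b"
  have "(\<lambda>t. F t (u t)) absolutely_integrable_on {x..y}"
    by (rule absolutely_integrable_on_subinterval[OF ai]) (use xy in auto)
  moreover have "integral {x..y} (\<lambda>t. F t (u t)) = u y - u x"
    using integral_solutionD[OF sol xy] by blast
  ultimately show "norm (u y - u x) \<le> integral {x..y} (\<lambda>t. norm (F t (u t)))"
    using integral_norm_bound_integral[of "\<lambda>t. F t (u t)" "{x..y}" "\<lambda>t. norm (F t (u t))"]
    by (simp add: absolutely_integrable_on_def)
qed auto

lemma integral_solution_imp_AE_derivative:
  assumes sol: "integral_solution F a b u" and "a \<le> b"
  shows "AE t in lebesgue. t \<in> {a<..<b} \<longrightarrow> (u has_vector_derivative F t (u t)) (at t)"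
proof -
  let ?f = "\<lambda>t. F t (u t)"
  have "?f integrable_on {a..b}" using integral_solutionD[OF sol order_refl \<open>a \<le> b\<close> order_refl] by blast
  note neg = negligible_not_differentiable_indefinite_integral[OF this]
  have key: "(u has_vector_derivative ?f t) (at t)"
    if t: "t \<in> {a<..<b}" and d: "((\<lambda>t. integral {a..t} ?f) has_vector_derivative ?f t) (at t)" for t
  proof -
    have "((\<lambda>t. u a + integral {a..t} ?f) has_vector_derivative ?f t) (at t)"
      using d by (auto intro!: derivative_eq_intros)
    then show ?thesis
    proof (rule has_vector_derivative_transform_within_open[of _ _ _ "{a<..<b}"])
      fix x assume "x \<in> {a<..<b}"
      then have "integral {a..x} ?f = u x - u a"
        using integral_solutionD[OF sol, of a x] by (intro integral_unique) auto
      then show "u a + integral {a..x} ?f = u x" by simp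
    qed (use t in auto)
  qed
  show ?thesis unfolding eventually_ae_filter_negligible
    by (rule exI, rule conjI[OF neg]) (use key in auto)
qed

lemma integral_solution_imp_caratheodory_solution:
  assumes sol: "integral_solution F a b u" and ai: "(\<lambda>t. F t (u t)) absolutely_integrable_on {a..b}"
    and "a \<le> b"
  shows "caratheodory_solution F {a..b} u"
  unfolding caratheodory_solution_def
proof (intro conjI allI impI)
  show "is_interval {a..b}" by (rule is_interval_cc)
  show "abs_continuous_fun x y u" if "x \<le> y \<and> {x..y} \<subseteq> {a..b}" for x y
    using abs_continuous_fun_subinterval[OF integral_solution_imp_abs_continuous_fun[OF sol ai]] that by auto
  have "AE t in lebesgue. t \<noteq> a \<and> t \<noteq> b"
    unfolding eventually_ae_filter_negligible by (rule exI[of _ "{a, b}"]) auto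
  with integral_solution_imp_AE_derivative[OF sol \<open>a \<le> b\<close>]
  show "AE t in lebesgue. t \<in> {a..b} \<longrightarrow> (u has_vector_derivative F t (u t)) (at t within {a..b})"
    by eventually_elim (auto intro: has_vector_derivative_at_within)
qed

lemma integral_solution_imp_caratheodory_solution_UNIV:
  assumes sol: "\<And>a b. a \<le> b \<Longrightarrow> integral_solution F a b u"
    and ai: "\<And>a b. a \<le> b \<Longrightarrow> (\<lambda>t. F t (u t)) absolutely_integrable_on {a..b}"
  shows "caratheodory_solution F UNIV u"
  unfolding caratheodory_solution_def
proof (intro conjI allI impI)
  show "abs_continuous_fun x y u" if "x \<le> y \<and> {x..y} \<subseteq> UNIV" for x y
    using that sol ai by (intro integral_solution_imp_abs_continuous_fun) auto
  have "AE t in lebesgue. \<forall>n::nat. t \<in> {- real n<..<real n} \<longrightarrow> (u has_vector_derivative F t (u t)) (at t)"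
    unfolding AE_all_countable by (intro allI integral_solution_imp_AE_derivative sol) auto
  then show "AE t in lebesgue. t \<in> UNIV \<longrightarrow> (u has_vector_derivative F t (u t)) (at t within UNIV)"
  proof eventually_elim
    case (elim t)
    obtain n where "\<bar>t\<bar> < real n" using reals_Archimedean2 by blast
    with elim[rule_format, of n] show ?case by (simp add: abs_less_iff)
  qed
qed (simp add: is_interval_univ)

text \<open>The bound is uniform in the state, so solutions exist on all of \<open>{a..b}\<close>
  and share a modulus of continuity. Bound and continuity are asked at every time, which keeps null
  sets out of the limit arguments; \<open>truncated\<close> is built to comply.\<close>

locale bounded_caratheodory =
  fixes G :: "real \<Rightarrow> 'a::euclidean_space \<Rightarrow> 'a" and a b :: real and m :: "real \<Rightarrow> real"
  assumes ab: "a \<le> b"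
    and meas: "\<And>z. (\<lambda>t. G t z) \<in> borel_measurable lebesgue"
    and cont: "\<And>t. continuous_on UNIV (G t)"
    and bound: "\<And>t z. t \<in> {a..b} \<Longrightarrow> norm (G t z) \<le> m t"
    and m_ai: "m absolutely_integrable_on {a..b}"
begin

lemma m_integrable: "m integrable_on {a..b}"
  using m_ai by (simp add: absolutely_integrable_on_def)

lemma m_integrable_subinterval: "a \<le> x \<Longrightarrow> y \<le> b \<Longrightarrow> m integrable_on {x..y}"
  by (rule integrable_on_subinterval[OF m_integrable]) auto

lemma compose_absolutely_integrable:
  assumes "continuous_on {a..b} w"
  shows "(\<lambda>t. G t (w t)) absolutely_integrable_on {a..b}"
proof -
  \<comment> \<open>Clamping the time extends \<open>w\<close> continuously to the whole line, where
    continuity gives measurability.\<close>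
  define c where "c t = max a (min b t)" for t
  have "continuous_on UNIV (\<lambda>t. w (c t))"
    by (rule continuous_on_compose2[OF assms]) (use ab in \<open>auto simp: c_def intro!: continuous_intros\<close>)
  then have "(\<lambda>t. w (c t)) \<in> borel_measurable lebesgue"
    by (intro measurable_completion) (simp add: borel_measurable_continuous_onI)
  then have "(\<lambda>t. G t (w (c t))) \<in> borel_measurable lebesgue"
    by (rule borel_measurable_caratheodory_compose[OF meas cont])
  then have "(\<lambda>t. G t (w (c t))) \<in> borel_measurable (lebesgue_on {a..b})"
    by (rule measurable_restrict_space1)
  then have "(\<lambda>t. G t (w (c t))) absolutely_integrable_on {a..b}"
    by (rule measurable_bounded_by_integrable_imp_absolutely_integrable) (use m_integrable bound in auto)
  then show ?thesis
    by (rule absolutely_integrable_spike[where S = "{}"]) (auto simp: c_def)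
qed

text \<open>\<open>u\<close> need not be a solution: the field is evaluated along another curve \<open>w\<close>.\<close>

definition driven :: "(real \<Rightarrow> 'a) \<Rightarrow> (real \<Rightarrow> 'a) \<Rightarrow> bool" where
  "driven w u \<longleftrightarrow> (\<forall>x y. a \<le> x \<and> x \<le> y \<and> y \<le> b \<longrightarrow> ((\<lambda>t. G t (w t)) has_integral (u y - u x)) {x..y})"

lemma driven_self: "driven u u \<longleftrightarrow> integral_solution G a b u"
  by (simp add: driven_def integral_solution_def)

lemma driven_increment:
  assumes "driven w u" "a \<le> x" "x \<le> y" "y \<le> b"
  shows "norm (u y - u x) \<le> integral {x..y} m"
proof -
  have h: "((\<lambda>t. G t (w t)) has_integral (u y - u x)) {x..y}" using assms by (simp add: driven_def)
  have "norm (integral {x..y} (\<lambda>t. G t (w t))) \<le> integral {x..y} m"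
    using h assms bound by (intro integral_norm_bound_integral m_integrable_subinterval) auto
  then show ?thesis using h integral_unique by metis
qed

text \<open>The primitive of \<open>m\<close> is a modulus of continuity common to all driven
  curves, whatever \<open>w\<close> is; the absolute value covers both orders of \<open>x\<close>
  and \<open>y\<close>.\<close>

lemma driven_dist:
  assumes "driven w u" "x \<in> {a..b}" "y \<in> {a..b}"
  shows "norm (u y - u x) \<le> \<bar>integral {a..y} m - integral {a..x} m\<bar>"
proof -
  have *: "norm (u y - u x) \<le> \<bar>integral {a..y} m - integral {a..x} m\<bar>"
    if "x \<le> y" "x \<in> {a..b}" "y \<in> {a..b}" for x y
  proof -
    have "integral {a..x} m + integral {x..y} m = integral {a..y} m"
      by (rule Henstock_Kurzweil_Integration.integral_combine) (use that m_integrable_subinterval in auto)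
    then show ?thesis using driven_increment[OF assms(1), of x y] that by auto
  qed
  show ?thesis using *[of x y] *[of y x] assms
    by (cases "x \<le> y") (simp_all add: norm_minus_commute[of "u x"] abs_minus_commute[of "integral {a..x} m"])
qed

lemma driven_equicontinuous:
  assumes x: "x \<in> {a..b}" and "e > 0"
  obtains d where "d > 0" "\<And>w u y. driven w u \<Longrightarrow> y \<in> {a..b} \<Longrightarrow> norm (x - y) < d \<Longrightarrow> norm (u x - u y) < e"
proof -
  have "continuous_on {a..b} (\<lambda>t. integral {a..t} m)"
    by (rule indefinite_integral_continuous_1[OF m_integrable])
  then obtain d where d: "d > 0"
    "\<And>y. y \<in> {a..b} \<Longrightarrow> dist y x < d \<Longrightarrow> dist (integral {a..y} m) (integral {a..x} m) < e"
    using x \<open>e > 0\<close> unfolding continuous_on_iff by blast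
  have "norm (u x - u y) < e" if "driven w u" "y \<in> {a..b}" "norm (x - y) < d" for w u y
  proof -
    have "dist y x < d" using that(3) by (simp add: dist_norm norm_minus_commute)
    from d(2)[OF that(2) this] have "\<bar>integral {a..y} m - integral {a..x} m\<bar> < e" by (simp add: dist_real_def)
    with driven_dist[OF that(1) x that(2)] show ?thesis by (simp add: norm_minus_commute[of "u x"])
  qed
  with d(1) show thesis by (rule that)
qed

lemma driven_continuous:
  assumes "driven w u"
  shows "continuous_on {a..b} u"
  unfolding continuous_on_iff
proof (intro ballI allI impI)
  fix x e :: real assume x: "x \<in> {a..b}" and "e > 0"
  then obtain d where "d > 0"
    "\<And>w u y. driven w u \<Longrightarrow> y \<in> {a..b} \<Longrightarrow> norm (x - y) < d \<Longrightarrow> norm (u x - u y) < e"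
    using driven_equicontinuous by metis
  with assms show "\<exists>d>0. \<forall>y\<in>{a..b}. dist y x < d \<longrightarrow> dist (u y) (u x) < e"
    by (metis dist_commute dist_norm)
qed

text \<open>Arzela-Ascoli gives a uniform limit, dominated convergence its integral equation. The
  drivers only have to approach the curves, which covers exact as well as approximate solutions, and
  the times \<open>s n\<close> at which a bound is known may vary.\<close>

lemma driven_compactness:
  assumes dr: "\<And>n. driven (w n) (u n)" and wc: "\<And>n. continuous_on {a..b} (w n)"
    and wu: "\<And>t. t \<in> {a..b} \<Longrightarrow> (\<lambda>n. w n t - u n t) \<longlonglongrightarrow> 0"
    and s: "\<And>n. s n \<in> {a..b}" and B: "\<And>n. norm (u n (s n)) \<le> B"
  shows "\<exists>v r. strict_mono (r :: nat \<Rightarrow> nat) \<and> integral_solution G a b v \<and>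
    uniform_limit {a..b} (\<lambda>n. u (r n)) v sequentially"
proof -
  have m0: "0 \<le> m t" if "t \<in> {a..b}" for t using bound[OF that, of 0] norm_ge_zero order_trans by blast
  have bnd: "norm (u n t) \<le> B + integral {a..b} m" if "t \<in> {a..b}" for n t
  proof -
    have le: "0 \<le> integral {a..t} m \<and> integral {a..t} m \<le> integral {a..b} m" if "t \<in> {a..b}" for t
      using that m0 by (auto intro!: integral_subset_le m_integrable m_integrable_subinterval integral_nonneg)
    have "norm (u n t) \<le> norm (u n (s n)) + norm (u n t - u n (s n))" by norm
    also have "\<dots> \<le> B + integral {a..b} m"
      using driven_dist[OF dr s that, of n n] le[OF that] le[OF s[of n]] B[of n] by linarith
    finally show ?thesis .
  qed
  have equi: "\<exists>d>0. \<forall>n y. y \<in> {a..b} \<and> norm (x - y) < d \<longrightarrow> norm (u n x - u n y) < e"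
    if x: "x \<in> {a..b}" and "0 < e" for x e
    using driven_equicontinuous[OF that] dr by metis
  obtain v r where v: "continuous_on {a..b} v" and r: "strict_mono (r :: nat \<Rightarrow> nat)"
    and lim: "\<And>e. 0 < e \<Longrightarrow> \<exists>N. \<forall>n x. n \<ge> N \<and> x \<in> {a..b} \<longrightarrow> norm (u (r n) x - v x) < e"
    by (rule Arzela_Ascoli[of "{a..b}" u, OF _ bnd equi]) auto
  have ul: "uniform_limit {a..b} (\<lambda>n. u (r n)) v sequentially"
    unfolding uniform_limit_sequentially_iff using lim by (metis dist_norm)
  have pt: "(\<lambda>n. u (r n) t) \<longlonglongrightarrow> v t" if "t \<in> {a..b}" for t
    using tendsto_uniform_limitI[OF ul that] .
  have "((\<lambda>t. G t (v t)) has_integral (v y - v x)) {x..y}" if xy: "a \<le> x" "x \<le> y" "y \<le> b" for x y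
  proof -
    have h: "((\<lambda>t. G t (w (r n) t)) has_integral (u (r n) y - u (r n) x)) {x..y}" for n
      using dr[of "r n"] xy by (simp add: driven_def)
    have ptw: "(\<lambda>n. G t (w (r n) t)) \<longlonglongrightarrow> G t (v t)" if t: "t \<in> {x..y}" for t
    proof -
      have tab: "t \<in> {a..b}" using t xy by auto
      have "(\<lambda>n. (w (r n) t - u (r n) t) + u (r n) t) \<longlonglongrightarrow> 0 + v t"
        by (intro tendsto_add pt tab LIMSEQ_subseq_LIMSEQ[OF wu r, unfolded o_def])
      then have "(\<lambda>n. w (r n) t) \<longlonglongrightarrow> v t" by simp
      then show ?thesis by (rule continuous_on_tendsto_compose[OF cont[of t]]) auto
    qed
    have 1: "(\<lambda>t. G t (v t)) integrable_on {x..y}" and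
      2: "(\<lambda>n. integral {x..y} (\<lambda>t. G t (w (r n) t))) \<longlonglongrightarrow> integral {x..y} (\<lambda>t. G t (v t))"
      using dominated_convergence[of "\<lambda>n t. G t (w (r n) t)" "{x..y}" m "\<lambda>t. G t (v t)"]
        h m_integrable_subinterval[of x y] bound xy ptw by (auto simp: has_integral_integrable)
    have "(\<lambda>n. integral {x..y} (\<lambda>t. G t (w (r n) t))) = (\<lambda>n. u (r n) y - u (r n) x)"
      using h integral_unique by blast
    moreover have "(\<lambda>n. u (r n) y - u (r n) x) \<longlonglongrightarrow> v y - v x"
      by (intro tendsto_diff pt) (use xy in auto)
    ultimately have "integral {x..y} (\<lambda>t. G t (v t)) = v y - v x"
      using 2 LIMSEQ_unique by metis
    then show ?thesis using integrable_integral[OF 1] by simp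
  qed
  then have "integral_solution G a b v" by (simp add: integral_solution_def)
  then show ?thesis using r ul by blast
qed

lemmas solution_continuous = driven_continuous[of u u for u, unfolded driven_self]

lemma solution_compactness:
  assumes "\<And>n. integral_solution G a b (u n)" "\<And>n. s n \<in> {a..b}" "\<And>n. norm (u n (s n)) \<le> B"
  shows "\<exists>v r. strict_mono (r :: nat \<Rightarrow> nat) \<and> integral_solution G a b v \<and>
    uniform_limit {a..b} (\<lambda>n. u (r n)) v sequentially"
  using driven_compactness[of u u s B] assms solution_continuous by (simp add: driven_self)

end

text \<open>A difference of integrals from \<open>a\<close> serves as the oriented integral from
  \<open>s\<close> to \<open>t\<close>, so that curves can be followed backwards in time as
  well.\<close>

lemma integral_diff_cong:
  fixes f g :: "real \<Rightarrow> 'a::banach"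
  assumes f: "f integrable_on {a..b}" and g: "g integrable_on {a..b}" and st: "s \<in> {a..b}" "t \<in> {a..b}"
    and eq: "\<And>x. min s t \<le> x \<Longrightarrow> x \<le> max s t \<Longrightarrow> f x = g x"
  shows "integral {a..t} f - integral {a..s} f = integral {a..t} g - integral {a..s} g"
proof -
  have *: "integral {a..y} h - integral {a..x} h = integral {x..y} h"
    if "h integrable_on {a..b}" "a \<le> x" "x \<le> y" "y \<le> b" for h :: "real \<Rightarrow> 'a" and x y
  proof -
    have "h integrable_on {a..y}" by (rule integrable_on_subinterval[OF that(1)]) (use that in auto)
    from Henstock_Kurzweil_Integration.integral_combine[OF that(2,3) this] show ?thesis
      by (simp add: algebra_simps)
  qed
  show ?thesis
  proof (cases "s \<le> t")
    case True
    then have "integral {s..t} f = integral {s..t} g" by (intro integral_cong eq) auto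
    then show ?thesis using *[OF f, of s t] *[OF g, of s t] st True by simp
  next
    case False
    then have "integral {t..s} f = integral {t..s} g" by (intro integral_cong eq) auto
    then show ?thesis using *[OF f, of t s] *[OF g, of t s] st False
      by (metis atLeastAtMost_iff linorder_le_cases minus_diff_eq)
  qed
qed

section \<open>Delayed approximations and Peano's existence theorem\<close>

context bounded_caratheodory
begin

lemma integral_operator_driven:
  assumes "continuous_on {a..b} w"
  shows "driven w (\<lambda>t. z + integral {a..t} (\<lambda>x. G x (w x)) - integral {a..s} (\<lambda>x. G x (w x)))"
  unfolding driven_def
proof (intro allI impI, elim conjE)
  fix x y assume xy: "a \<le> x" "x \<le> y" "y \<le> b"
  have i: "(\<lambda>x. G x (w x)) integrable_on {a..b}"
    using compose_absolutely_integrable[OF assms] by (simp add: absolutely_integrable_on_def)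
  have ay: "(\<lambda>x. G x (w x)) integrable_on {a..y}" and xy': "(\<lambda>x. G x (w x)) integrable_on {x..y}"
    by (rule integrable_on_subinterval[OF i]; use xy in auto)+
  from Henstock_Kurzweil_Integration.integral_combine[OF xy(1,2) ay] integrable_integral[OF xy']
  show "((\<lambda>t. G t (w t)) has_integral (z + integral {a..y} (\<lambda>x. G x (w x)) - integral {a..s} (\<lambda>x. G x (w x)) -
      (z + integral {a..x} (\<lambda>x. G x (w x)) - integral {a..s} (\<lambda>x. G x (w x))))) {x..y}"
    by (metis (no_types, lifting) add_diff_cancel_left add_diff_cancel_left' add_diff_eq diff_diff_eq2 diff_add_cancel)
qed

text \<open>Tonelli's approximation: if the state is read off with a delay \<open>h\<close> towards the initial time, the
  Picard iterates become stationary after finitely many steps.\<close>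

lemma delayed_solution:
  assumes s: "s \<in> {a..b}" and h: "h > 0"
  obtains u w where "driven w u" "continuous_on {a..b} w" "u s = z"
    "\<And>t. t \<in> {a..b} \<Longrightarrow> \<exists>x\<in>{a..b}. \<bar>x - t\<bar> \<le> h \<and> w t = u x"
proof -
  \<comment> \<open>One of the two terms equals \<open>s\<close>, depending on the side of
    \<open>t\<close>; the other moves \<open>t\<close> towards \<open>s\<close> by \<open>h\<close>
    and stops at \<open>s\<close>.\<close>
  define d where "d t = max s (t - h) + min s (t + h) - s" for t
  have d1: "d t \<in> {a..b}" "\<bar>d t - t\<bar> \<le> h" if "t \<in> {a..b}" for t
    using that s h by (auto simp: d_def)
  have d2: "min s t \<le> d t" "d t \<le> max s t" for t
    using h by (auto simp: d_def)
  have d3: "\<bar>d t - s\<bar> \<le> real k * h" if "\<bar>t - s\<bar> \<le> real (Suc k) * h" for t k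
  proof -
    have "0 \<le> real k * h" "real (Suc k) * h = real k * h + h" using h by (simp_all add: algebra_simps)
    with that h show ?thesis unfolding d_def by (auto simp: max_def min_def abs_if split: if_splits)
  qed
  have dc: "continuous_on {a..b} d" unfolding d_def by (intro continuous_intros)
  define P where "P v = (\<lambda>t. z + integral {a..t} (\<lambda>x. G x (v (d x))) - integral {a..s} (\<lambda>x. G x (v (d x))))" for v
  have P_apply: "P v t = z + (integral {a..t} (\<lambda>x. G x (v (d x))) - integral {a..s} (\<lambda>x. G x (v (d x))))" for v t
    by (simp add: P_def)
  have comp: "continuous_on {a..b} (\<lambda>x. v (d x))" if "continuous_on {a..b} v" for v :: "real \<Rightarrow> 'a"
    by (rule continuous_on_compose2[OF that dc]) (use d1 in auto)
  have Pd: "driven (\<lambda>x. v (d x)) (P v)" if "continuous_on {a..b} v" for v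
    unfolding P_def by (rule integral_operator_driven[OF comp[OF that]])
  have cont_it: "continuous_on {a..b} ((P ^^ k) (\<lambda>_. z))" for k
    by (induction k) (auto intro: driven_continuous Pd)
  have int: "(\<lambda>x. G x (v (d x))) integrable_on {a..b}" if "continuous_on {a..b} v" for v
    using compose_absolutely_integrable[OF comp[OF that]] by (simp add: absolutely_integrable_on_def)
  \<comment> \<open>Stationarity spreads from \<open>s\<close> at the rate \<open>h\<close> per
    iteration: by \<open>d3\<close>, a value within distance \<open>(k + 1) h\<close> of
    \<open>s\<close> involves the previous iterate only within distance \<open>k h\<close>.\<close>
  have stat: "(P ^^ Suc k) (\<lambda>_. z) t = (P ^^ k) (\<lambda>_. z) t" if "t \<in> {a..b}" "\<bar>t - s\<bar> \<le> real k * h" for k t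
    using that
  proof (induction k arbitrary: t)
    case 0
    then show ?case by (simp add: P_def)
  next
    case (Suc k)
    let ?v = "(P ^^ k) (\<lambda>_. z)"
    have "integral {a..t} (\<lambda>x. G x (P ?v (d x))) - integral {a..s} (\<lambda>x. G x (P ?v (d x)))
      = integral {a..t} (\<lambda>x. G x (?v (d x))) - integral {a..s} (\<lambda>x. G x (?v (d x)))"
    proof (rule integral_diff_cong)
      show "(\<lambda>x. G x (P ?v (d x))) integrable_on {a..b}" using int[OF cont_it[of "Suc k"]] by simp
      show "(\<lambda>x. G x (?v (d x))) integrable_on {a..b}" using int[OF cont_it[of k]] .
      fix x assume x: "min s t \<le> x" "x \<le> max s t"
      then have "x \<in> {a..b}" using s Suc.prems by auto
      moreover have "\<bar>x - s\<bar> \<le> real (Suc k) * h" using x Suc.prems by auto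
      ultimately have "P ?v (d x) = ?v (d x)" using Suc.IH[OF d1(1) d3] by simp
      then show "G x (P ?v (d x)) = G x (?v (d x))" by simp
    qed (use s Suc.prems in auto)
    then have "P (P ?v) t = P ?v t" unfolding P_apply[of "P ?v" t] P_apply[of ?v t] by (simp only:)
    then show ?case by simp
  qed
  obtain N where N: "(b - a) / h \<le> real N" using real_arch_simple by blast
  define v where "v = (P ^^ N) (\<lambda>_. z)"
  have eq: "P v t = v t" if "t \<in> {a..b}" for t
  proof -
    have "\<bar>t - s\<bar> \<le> b - a" using that s by auto
    also have "\<dots> \<le> real N * h" using N h by (simp add: field_simps)
    finally show ?thesis using stat[OF that] by (simp add: v_def)
  qed
  have vc: "continuous_on {a..b} v" unfolding v_def by (rule cont_it)
  show thesis
  proof (rule that[of "\<lambda>x. v (d x)" "P v"])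
    show "driven (\<lambda>x. v (d x)) (P v)" by (rule Pd[OF vc])
    show "continuous_on {a..b} (\<lambda>x. v (d x))" by (rule comp[OF vc])
    show "P v s = z" by (simp add: P_def)
    show "\<exists>x\<in>{a..b}. \<bar>x - t\<bar> \<le> h \<and> v (d t) = P v x" if "t \<in> {a..b}" for t
      using d1[OF that] eq by (intro bexI[of _ "d t"]) auto
  qed
qed

text \<open>With delays tending to zero, equicontinuity forces driver and curve together, so a limit
  of the delayed curves solves the equation.\<close>

theorem peano_existence:
  assumes s: "s \<in> {a..b}"
  shows "\<exists>u. integral_solution G a b u \<and> u s = z"
proof -
  have "\<exists>u w. driven w u \<and> continuous_on {a..b} w \<and> u s = z \<and>
    (\<forall>t\<in>{a..b}. \<exists>x\<in>{a..b}. \<bar>x - t\<bar> \<le> inverse (real (Suc n)) \<and> w t = u x)" for n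
    by (rule delayed_solution[OF s, of "inverse (real (Suc n))" z]) (simp, blast)
  then obtain u w where dr: "\<And>n. driven (w n) (u n)" and wc: "\<And>n. continuous_on {a..b} (w n)"
    and us: "\<And>n. u n s = z"
    and w: "\<And>n t. t \<in> {a..b} \<Longrightarrow> \<exists>x\<in>{a..b}. \<bar>x - t\<bar> \<le> inverse (real (Suc n)) \<and> w n t = u n x"
    by metis
  have "(\<lambda>n. w n t - u n t) \<longlonglongrightarrow> 0" if t: "t \<in> {a..b}" for t
    unfolding LIMSEQ_iff
  proof (intro allI impI)
    fix e :: real assume "e > 0"
    then obtain d where d: "d > 0"
      "\<And>w u y. driven w u \<Longrightarrow> y \<in> {a..b} \<Longrightarrow> norm (t - y) < d \<Longrightarrow> norm (u t - u y) < e"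
      using driven_equicontinuous[OF t] by metis
    obtain n0 where n0: "inverse (real (Suc n0)) < d" using reals_Archimedean[OF d(1)] by blast
    have "norm (w n t - u n t - 0) < e" if "n \<ge> n0" for n
    proof -
      obtain x where x: "x \<in> {a..b}" "\<bar>x - t\<bar> \<le> inverse (real (Suc n))" "w n t = u n x" using w[OF t] by blast
      have "inverse (real (Suc n)) \<le> inverse (real (Suc n0))" using that by simp
      then have "norm (t - x) < d" using x(2) n0 unfolding real_norm_def by linarith
      then show ?thesis using d(2)[OF dr x(1), of n] x(3) by (simp add: norm_minus_commute)
    qed
    then show "\<exists>n0. \<forall>n\<ge>n0. norm (w n t - u n t - 0) < e" by blast
  qed
  then obtain v r where v: "integral_solution G a b v" and ul: "uniform_limit {a..b} (\<lambda>n. u (r n)) v sequentially"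
    using driven_compactness[of w u "\<lambda>_. s" "norm z"] dr wc s us by auto
  have "(\<lambda>n. u (r n) s) \<longlonglongrightarrow> v s" by (rule tendsto_uniform_limitI[OF ul s])
  then have "v s = z" by (simp add: us LIMSEQ_const_iff)
  with v show ?thesis by blast
qed

end

section \<open>Continuity and restriction of Caratheodory solutions\<close>

lemma abs_continuous_fun_imp_continuous_on:
  fixes u :: "real \<Rightarrow> 'a::metric_space"
  assumes "abs_continuous_fun a b u"
  shows "continuous_on {a..b} u"
  unfolding continuous_on_iff
proof (intro ballI allI impI)
  fix x e :: real assume x: "x \<in> {a..b}" and "e > 0"
  then obtain d where d: "d > 0" "\<And>D::(real \<times> real) set.
        finite D \<and> (\<forall>(x, y)\<in>D. a \<le> x \<and> x \<le> y \<and> y \<le> b) \<and>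
        disjoint_family_on (\<lambda>(x, y). {x<..<y}) D \<and> (\<Sum>(x, y)\<in>D. y - x) < d \<Longrightarrow>
        (\<Sum>(x, y)\<in>D. dist (u x) (u y)) < e"
    using assms unfolding abs_continuous_fun_def by blast
  have *: "dist (u v) (u w) < e" if "a \<le> v" "v \<le> w" "w \<le> b" "w - v < d" for v w
    using d(2)[of "{(v, w)}"] that by (simp add: disjoint_family_on_def)
  have "dist (u y) (u x) < e" if "y \<in> {a..b}" "dist y x < d" for y
    using *[of x y] *[of y x] x that by (cases "x \<le> y") (auto simp: dist_real_def dist_commute)
  then show "\<exists>d>0. \<forall>y\<in>{a..b}. dist y x < d \<longrightarrow> dist (u y) (u x) < e" using d(1) by blast
qed

lemma caratheodory_solution_continuous_on:
  assumes "caratheodory_solution F {a..b} u"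
  shows "continuous_on {a..b} u"
proof (cases "a \<le> b")
  case True
  then show ?thesis using assms unfolding caratheodory_solution_def
    by (intro abs_continuous_fun_imp_continuous_on) auto
qed auto

lemma caratheodory_solution_subinterval:
  assumes "caratheodory_solution F {a..b} u" "a \<le> x" "y \<le> b"
  shows "caratheodory_solution F {x..y} u"
proof -
  have sub: "{x..y} \<subseteq> {a..b}" using assms by auto
  have "AE t in lebesgue. t \<in> {a..b} \<longrightarrow> (u has_vector_derivative F t (u t)) (at t within {a..b})"
    using assms(1) by (simp add: caratheodory_solution_def)
  then have "AE t in lebesgue. t \<in> {x..y} \<longrightarrow> (u has_vector_derivative F t (u t)) (at t within {x..y})"
  proof eventually_elim
    case (elim t)
    then show ?case using sub has_vector_derivative_within_subset[OF _ sub] by blast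
  qed
  then show ?thesis using assms(1) sub unfolding caratheodory_solution_def
    by (meson is_interval_cc order_trans)
qed

section \<open>Truncated fields and continuous dependence\<close>

lemma uniform_limit_eventually_norm_less:
  fixes v :: "'b::topological_space \<Rightarrow> 'a::real_normed_vector"
  assumes ul: "uniform_limit K w v F" and "compact K" "continuous_on K v"
    and less: "\<And>x. x \<in> K \<Longrightarrow> norm (v x) < R"
  shows "eventually (\<lambda>n. \<forall>x\<in>K. norm (w n x) < R) F"
proof (cases "K = {}")
  case False
  obtain x0 where x0: "x0 \<in> K" "\<And>x. x \<in> K \<Longrightarrow> norm (v x) \<le> norm (v x0)"
    using continuous_attains_sup[OF \<open>compact K\<close> False, of "\<lambda>x. norm (v x)"] assms(3) continuous_on_norm by metis
  then have "R - norm (v x0) > 0" using less by simp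
  from uniform_limitD[OF ul this] show ?thesis
  proof eventually_elim
    case (elim n)
    show ?case
    proof
      fix x assume "x \<in> K"
      then show "norm (w n x) < R" using elim[rule_format, of x] x0(2)[of x] norm_triangle_ineq2[of "w n x" "v x"]
        by (auto simp: dist_norm)
    qed
  qed
qed simp

lemma uniform_limit_subsequences:
  assumes "\<And>r. strict_mono (r :: nat \<Rightarrow> nat) \<Longrightarrow>
    \<exists>q. strict_mono (q :: nat \<Rightarrow> nat) \<and> uniform_limit K (\<lambda>n. w (r (q n))) v sequentially"
  shows "uniform_limit K w v sequentially"
proof (rule ccontr)
  assume "\<not> uniform_limit K w v sequentially"
  then obtain e where e: "e > 0" "\<not> (\<forall>\<^sub>F n in sequentially. \<forall>x\<in>K. dist (w n x) (v x) < e)"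
    unfolding uniform_limit_iff by blast
  then have "infinite {n. \<not> (\<forall>x\<in>K. dist (w n x) (v x) < e)}"
    unfolding eventually_sequentially infinite_nat_iff_unbounded_le by blast
  from infinite_enumerate[OF this] obtain r :: "nat \<Rightarrow> nat" where r: "strict_mono r"
      "\<forall>n. r n \<in> {n. \<not> (\<forall>x\<in>K. dist (w n x) (v x) < e)}" by blast
  from assms[OF r(1)] obtain q where "uniform_limit K (\<lambda>n. w (r (q n))) v sequentially" by blast
  from uniform_limitD[OF this e(1)] r(2) show False by (simp add: eventually_sequentially) blast
qed

locale planar_field =
  fixes F :: "real \<Rightarrow> real^2 \<Rightarrow> real^2" and T :: real
  assumes T: "T > 0"
    and car: "caratheodory F"
    and cont_F: "\<And>t. continuous_on UNIV (F t)"
    and uniq: "unique_solutions F"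
begin

lemma unique:
  assumes "caratheodory_solution F {x..y} u" "caratheodory_solution F {x..y} v"
    "s \<in> {x..y}" "u s = v s" "t \<in> {x..y}"
  shows "u t = v t"
  using uniq[unfolded unique_solutions_def, rule_format, of s "{x..y}" u v "u s" t] assms by simp

text \<open>One majorant is fixed per radius, so that the constants derived from it depend on the
  radius alone and not on the solution considered.\<close>

definition majorant :: "real \<Rightarrow> real \<Rightarrow> real" where
  "majorant R = (SOME m. m absolutely_integrable_on {0..T} \<and> (\<forall>t. 0 \<le> m t) \<and>
    (AE t in lebesgue. t \<in> {0..T} \<longrightarrow> (\<forall>z\<in>cball 0 R. norm (F t z) \<le> m t)))"

lemma majorant: "majorant R absolutely_integrable_on {0..T}" "0 \<le> majorant R t"
  "AE t in lebesgue. t \<in> {0..T} \<longrightarrow> (\<forall>z\<in>cball 0 R. norm (F t z) \<le> majorant R t)"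
proof -
  obtain m :: "real \<Rightarrow> real" where m: "m absolutely_integrable_on {0..T}"
    "AE t in lebesgue. t \<in> {0..T} \<longrightarrow> (\<forall>z\<in>cball 0 R. norm (F t z) \<le> m t)"
    using car[unfolded caratheodory_def, THEN conjunct2, THEN conjunct2, rule_format, of "cball 0 R" 0 T]
    by auto
  have "\<exists>m. m absolutely_integrable_on {0..T} \<and> (\<forall>t. 0 \<le> m t) \<and>
    (AE t in lebesgue. t \<in> {0..T} \<longrightarrow> (\<forall>z\<in>cball 0 R. norm (F t z) \<le> m t))"
  proof (intro exI conjI)
    show "(\<lambda>t. \<bar>m t\<bar>) absolutely_integrable_on {0..T}"
      using absolutely_integrable_norm[OF m(1)] by (simp add: o_def)
    show "AE t in lebesgue. t \<in> {0..T} \<longrightarrow> (\<forall>z\<in>cball 0 R. norm (F t z) \<le> \<bar>m t\<bar>)"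
      using m(2) by eventually_elim force
  qed simp
  from someI_ex[OF this, folded majorant_def] show "majorant R absolutely_integrable_on {0..T}" "0 \<le> majorant R t"
    "AE t in lebesgue. t \<in> {0..T} \<longrightarrow> (\<forall>z\<in>cball 0 R. norm (F t z) \<le> majorant R t)" by auto
qed

text \<open>The value \<open>0\<close> is taken only on a null set of times, where the bound of \<open>majorant\<close> fails.\<close>

definition truncated :: "real \<Rightarrow> real \<Rightarrow> real^2 \<Rightarrow> real^2" where
  "truncated R t z = (if t \<in> {0..T} \<longrightarrow> (\<forall>z\<in>cball 0 R. norm (F t z) \<le> majorant R t)
    then F t (closest_point (cball 0 R) z) else 0)"

lemma truncated_bounded_caratheodory:
  assumes "R \<ge> 0"
  shows "bounded_caratheodory (truncated R) 0 T (majorant R)"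
proof
  show "0 \<le> T" using T by simp
  have cp: "closest_point (cball 0 R) z \<in> cball 0 R" for z :: "real^2"
    by (rule closest_point_in_set) (use assms in auto)
  show "continuous_on UNIV (truncated R t)" for t
  proof -
    have cc: "continuous_on UNIV (closest_point (cball (0 :: real^2) R))"
      by (rule continuous_on_closest_point) (use assms in auto)
    have "continuous_on UNIV (\<lambda>z. F t (closest_point (cball 0 R) z))"
      by (rule continuous_on_compose2[OF cont_F cc]) auto
    then show ?thesis
    proof (cases "t \<in> {0..T} \<longrightarrow> (\<forall>z\<in>cball 0 R. norm (F t z) \<le> majorant R t)")
      case True
      show ?thesis unfolding truncated_def if_P[OF True] by fact
    next
      case False
      show ?thesis unfolding truncated_def if_not_P[OF False] by simp
    qed
  qed
  show "norm (truncated R t z) \<le> majorant R t" if "t \<in> {0..T}" for t z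
    using majorant(2)[of R t] cp[of z] that unfolding truncated_def by auto
  show "majorant R absolutely_integrable_on {0..T}" by (rule majorant)
  show "(\<lambda>t. truncated R t z) \<in> borel_measurable lebesgue" for z
  proof (rule borel_measurable_AE)
    show "(\<lambda>t. F t (closest_point (cball 0 R) z)) \<in> borel_measurable lebesgue"
      using car by (simp add: caratheodory_def)
    show "AE t in lebesgue. F t (closest_point (cball 0 R) z) = truncated R t z"
      using majorant(3)[of R] by eventually_elim (simp add: truncated_def)
  qed
qed

text \<open>The null set \<open>E\<close> leaves room for the single time at which a curve reaches
  the sphere, where only \<open>R \<le> norm (w t)\<close> is known.\<close>

lemma truncated_transfer:
  assumes sol: "integral_solution (truncated R) 0 T w" and "R \<ge> 0" and xy: "0 \<le> x" "y \<le> T"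
    and E: "negligible E" "\<And>t. t \<in> {x..y} - E \<Longrightarrow> norm (w t) \<le> R"
  shows "integral_solution F x y w" "(\<lambda>t. F t (w t)) absolutely_integrable_on {x..y}"
proof -
  interpret bounded_caratheodory "truncated R" 0 T "majorant R"
    by (rule truncated_bounded_caratheodory) fact
  obtain N where N: "negligible N"
    "{t. \<not> (t \<in> {0..T} \<longrightarrow> (\<forall>z\<in>cball 0 R. norm (F t z) \<le> majorant R t))} \<subseteq> N"
    using majorant(3)[of R] unfolding eventually_ae_filter_negligible by blast
  have neg: "negligible (N \<union> E)" using N E by (intro negligible_Un)
  have eq: "F t (w t) = truncated R t (w t)" if "t \<in> {x..y} - (N \<union> E)" for t
  proof -
    have "w t \<in> cball 0 R" using E(2)[of t] that by simp
    moreover have "t \<in> {0..T} \<longrightarrow> (\<forall>z\<in>cball 0 R. norm (F t z) \<le> majorant R t)" using that N by blast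
    ultimately show ?thesis unfolding truncated_def by (simp add: closest_point_self)
  qed
  show "integral_solution F x y w"
    unfolding integral_solution_def
  proof (intro allI impI, elim conjE)
    fix v u assume "x \<le> v" "v \<le> u" "u \<le> y"
    then show "((\<lambda>t. F t (w t)) has_integral (w u - w v)) {v..u}"
      using xy by (intro has_integral_spike[OF neg eq integral_solutionD[OF sol]]) auto
  qed
  have "(\<lambda>t. truncated R t (w t)) absolutely_integrable_on {x..y}"
    by (rule absolutely_integrable_on_subinterval[OF compose_absolutely_integrable[OF solution_continuous[OF sol]]])
      (use xy in auto)
  then show "(\<lambda>t. F t (w t)) absolutely_integrable_on {x..y}"
    by (rule absolutely_integrable_spike[OF _ neg eq])
qed

lemma truncated_solution_imp_caratheodory_solution:
  assumes "integral_solution (truncated R) 0 T w" "R \<ge> 0" "0 \<le> x" "x \<le> y" "y \<le> T"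
    "negligible E" "\<And>t. t \<in> {x..y} - E \<Longrightarrow> norm (w t) \<le> R"
  shows "caratheodory_solution F {x..y} w"
  using integral_solution_imp_caratheodory_solution[OF truncated_transfer[OF assms(1-3,5-7)] assms(4)] .

lemma truncated_solution_in_cball:
  assumes "integral_solution (truncated R) 0 T w" "R \<ge> 0" "\<And>t. t \<in> {0..T} \<Longrightarrow> norm (w t) \<le> R"
  shows "caratheodory_solution F {0..T} w"
  by (rule truncated_solution_imp_caratheodory_solution[where E = "{}"]) (use assms T in auto)

text \<open>The truncated equation may have several solutions beyond the sphere, but a solution
  \<open>v\<close> strictly inside is isolated from them: up to the first contact of
  \<open>w\<close> with the sphere both solve the original equation, hence agree there, and
  \<open>v\<close> never has norm \<open>R\<close>.\<close>

lemma truncated_unique: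
  assumes v: "caratheodory_solution F {0..T} v" and less: "\<And>t. t \<in> {0..T} \<Longrightarrow> norm (v t) < R"
    and w: "integral_solution (truncated R) 0 T w" and s: "s \<in> {0..T}" "w s = v s" and t: "t \<in> {0..T}"
  shows "w t = v t"
proof -
  have R: "R \<ge> 0" using less[OF s(1)] norm_ge_zero[of "v s"] by linarith
  interpret bounded_caratheodory "truncated R" 0 T "majorant R"
    by (rule truncated_bounded_caratheodory[OF R])
  define C where "C = {t \<in> {0..T}. R \<le> norm (w t)}"
  have "compact C"
  proof -
    have "C = {0..T} \<inter> (\<lambda>t. norm (w t)) -` {R..}" by (auto simp: C_def)
    moreover have "closed ({0..T} \<inter> (\<lambda>t. norm (w t)) -` {R..})"
      by (intro continuous_closed_preimage continuous_on_norm solution_continuous[OF w]) auto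
    ultimately have "closed C" by simp
    moreover have "bounded C" by (rule bounded_subset[OF bounded_closed_interval[of 0 T]]) (auto simp: C_def)
    ultimately show ?thesis by (simp add: compact_eq_bounded_closed)
  qed
  have "C = {}"
  proof (rule ccontr)
    assume "C \<noteq> {}"
    moreover have "continuous_on C (\<lambda>t. \<bar>t - s\<bar>)" by (intro continuous_intros)
    \<comment> \<open>The contact nearest to \<open>s\<close> is a first one in either direction of
      time.\<close>
    ultimately obtain \<tau> where \<tau>: "\<tau> \<in> C" "\<And>t. t \<in> C \<Longrightarrow> \<bar>\<tau> - s\<bar> \<le> \<bar>t - s\<bar>"
      using continuous_attains_inf[OF \<open>compact C\<close>, of "\<lambda>t. \<bar>t - s\<bar>"] by blast
    have inside: "norm (w t) \<le> R" if "t \<in> {min s \<tau>..max s \<tau>} - {\<tau>}" for t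
    proof -
      have "\<bar>t - s\<bar> < \<bar>\<tau> - s\<bar>" using that by (auto simp: min_def max_def abs_if split: if_splits)
      then have "t \<notin> C" using \<tau>(2)[of t] by linarith
      moreover have "t \<in> {0..T}" using that s \<tau>(1) by (auto simp: C_def)
      ultimately show ?thesis by (simp add: C_def)
    qed
    have "caratheodory_solution F {min s \<tau>..max s \<tau>} w"
      by (rule truncated_solution_imp_caratheodory_solution[OF w R _ _ _ negligible_sing[of \<tau>] inside])
        (use s \<tau>(1) in \<open>auto simp: C_def\<close>)
    moreover have "caratheodory_solution F {min s \<tau>..max s \<tau>} v"
      by (rule caratheodory_solution_subinterval[OF v]) (use s \<tau>(1) in \<open>auto simp: C_def\<close>)
    ultimately have "w \<tau> = v \<tau>" by (rule unique[of _ _ _ _ s]) (use s in auto)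
    then show False using less[of \<tau>] \<tau>(1) by (simp add: C_def)
  qed
  then have "norm (w t) \<le> R" if "t \<in> {0..T}" for t
    using that by (fastforce simp: C_def)
  then have "caratheodory_solution F {0..T} w"
    by (rule truncated_solution_in_cball[OF w R])
  then show ?thesis using unique[of 0 T w v s t] v s t by blast
qed

text \<open>Every subsequence has a further one converging to a truncated solution through
  \<open>(s', v s')\<close>, and \<open>truncated_unique\<close> makes this limit equal to
  \<open>v\<close>. The initial times may vary for the sake of solutions that come close to the
  origin at an uncontrolled moment.\<close>

lemma truncated_dependence:
  assumes v: "caratheodory_solution F {0..T} v" and less: "\<And>t. t \<in> {0..T} \<Longrightarrow> norm (v t) < R"
    and w: "\<And>n. integral_solution (truncated R) 0 T (w n)"
    and s: "\<And>n. s n \<in> {0..T}" "s \<longlonglongrightarrow> s'" "(\<lambda>n. w n (s n)) \<longlonglongrightarrow> v s'"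
  shows "uniform_limit {0..T} w v sequentially"
proof (rule uniform_limit_subsequences)
  fix r :: "nat \<Rightarrow> nat" assume r: "strict_mono r"
  have s': "s' \<in> {0..T}" by (rule Lim_in_closed_set[OF closed_atLeastAtMost _ _ s(2)]) (use s(1) in auto)
  have R: "R \<ge> 0" using less[OF s'] norm_ge_zero[of "v s'"] by linarith
  interpret bounded_caratheodory "truncated R" 0 T "majorant R"
    by (rule truncated_bounded_caratheodory[OF R])
  obtain B where B: "\<And>n. norm (w n (s n)) \<le> B"
    using convergent_imp_bounded[OF s(3)] unfolding bounded_iff by auto
  obtain q v' where q: "strict_mono (q :: nat \<Rightarrow> nat)" and v': "integral_solution (truncated R) 0 T v'"
    and ul: "uniform_limit {0..T} (\<lambda>n. w (r (q n))) v' sequentially"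
    using solution_compactness[of "\<lambda>n. w (r n)" "\<lambda>n. s (r n)" B] w s(1) B by blast
  have rq: "strict_mono (\<lambda>n. r (q n))" using strict_mono_o[OF r q] by (simp add: o_def)
  have srq: "(\<lambda>n. s (r (q n))) \<longlonglongrightarrow> s'" using LIMSEQ_subseq_LIMSEQ[OF s(2) rq] by (simp add: o_def)
  have "(\<lambda>n. w (r (q n)) (s (r (q n))) - v' (s (r (q n)))) \<longlonglongrightarrow> 0"
    unfolding LIMSEQ_iff
  proof (intro allI impI)
    fix e :: real assume "e > 0"
    with ul obtain N where "\<And>n x. n \<ge> N \<Longrightarrow> x \<in> {0..T} \<Longrightarrow> dist (w (r (q n)) x) (v' x) < e"
      unfolding uniform_limit_sequentially_iff by blast
    then show "\<exists>N. \<forall>n\<ge>N. norm (w (r (q n)) (s (r (q n))) - v' (s (r (q n))) - 0) < e"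
      using s(1) by (auto simp: dist_norm simp del: atLeastAtMost_iff)
  qed
  moreover have "(\<lambda>n. v' (s (r (q n)))) \<longlonglongrightarrow> v' s'"
    by (rule continuous_on_tendsto_compose[OF solution_continuous[OF v'] srq s']) (use s(1) in auto)
  ultimately have "(\<lambda>n. w (r (q n)) (s (r (q n)))) \<longlonglongrightarrow> v' s'"
    using tendsto_add[of _ 0] by fastforce
  moreover have "(\<lambda>n. w (r (q n)) (s (r (q n)))) \<longlonglongrightarrow> v s'"
    using LIMSEQ_subseq_LIMSEQ[OF s(3) rq] by (simp add: o_def)
  ultimately have "v' s' = v s'" by (rule LIMSEQ_unique)
  then have "v' t = v t" if "t \<in> {0..T}" for t
    using truncated_unique[OF v less v' s' _ that] by blast
  then have "uniform_limit {0..T} (\<lambda>n. w (r (q n))) v sequentially"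
    using ul by (simp add: uniform_limit_sequentially_iff)
  with q show "\<exists>q. strict_mono q \<and> uniform_limit {0..T} (\<lambda>n. w (r (q n))) v sequentially" by blast
qed

lemma solutions_near_origin_bounded:
  assumes zero: "\<And>s. s \<in> {0..T} \<Longrightarrow> \<exists>v. caratheodory_solution F {0..T} v \<and> v s = 0"
  obtains \<delta> R where "\<delta> > 0" "R > 0"
    "\<And>v s t. caratheodory_solution F {0..T} v \<Longrightarrow> s \<in> {0..T} \<Longrightarrow> norm (v s) \<le> \<delta> \<Longrightarrow> t \<in> {0..T} \<Longrightarrow> norm (v t) < R"
proof (rule ccontr)
  assume "\<not> thesis"
  with that have no: "\<exists>v s t. caratheodory_solution F {0..T} v \<and> s \<in> {0..T} \<and> norm (v s) \<le> \<delta> \<and> t \<in> {0..T} \<and> R \<le> norm (v t)"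
    if "\<delta> > 0" "R > 0" for \<delta> R using that by (meson not_le)
  have "\<exists>v s t. caratheodory_solution F {0..T} v \<and> s \<in> {0..T} \<and> norm (v s) \<le> inverse (real (Suc n)) \<and>
      t \<in> {0..T} \<and> real (Suc n) \<le> norm (v t)" for n
    by (rule no) auto
  then obtain v s t where v: "\<And>n. caratheodory_solution F {0..T} (v n)" and s: "\<And>n. s n \<in> {0..T}"
    and vs: "\<And>n. norm (v n (s n)) \<le> inverse (real (Suc n))"
    and t: "\<And>n. t n \<in> {0..T}" "\<And>n. real (Suc n) \<le> norm (v n (t n))"
    by metis
  obtain s' r where s': "s' \<in> {0..T}" and r: "strict_mono (r :: nat \<Rightarrow> nat)" and sr: "(\<lambda>n. s (r n)) \<longlonglongrightarrow> s'"
    using compact_Icc[of 0 T, unfolded compact_def, rule_format, of s] s by (auto simp: o_def)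
  obtain u where u: "caratheodory_solution F {0..T} u" "u s' = 0" using zero[OF s'] by blast
  have uc: "continuous_on {0..T} u" by (rule caratheodory_solution_continuous_on[OF u(1)])
  have "compact (u ` {0..T})" by (rule compact_continuous_image[OF uc compact_Icc])
  then obtain R where R: "R > 0" "\<And>t. t \<in> {0..T} \<Longrightarrow> norm (u t) < R"
    using compact_imp_bounded bounded_pos_less by (metis imageI)
  interpret bounded_caratheodory "truncated R" 0 T "majorant R"
    by (rule truncated_bounded_caratheodory) (use R in simp)
  \<comment> \<open>The given \<open>v n\<close> become large and need not solve the truncated
    equation. Solutions of it through the same points are built instead; once known to stay small
    they solve the original equation, and uniqueness identifies them with the given ones.\<close>
  have "\<exists>w. integral_solution (truncated R) 0 T w \<and> w (s (r n)) = v (r n) (s (r n))" for n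
    by (rule peano_existence[OF s])
  then obtain w where w: "\<And>n. integral_solution (truncated R) 0 T (w n)"
    "\<And>n. w n (s (r n)) = v (r n) (s (r n))" by metis
  have "(\<lambda>n. v n (s n)) \<longlonglongrightarrow> 0"
    by (rule Lim_null_comparison[OF _ LIMSEQ_inverse_real_of_nat]) (use vs in simp)
  from LIMSEQ_subseq_LIMSEQ[OF this r] have "(\<lambda>n. w n (s (r n))) \<longlonglongrightarrow> u s'" by (simp add: w u o_def)
  from truncated_dependence[OF u(1) R(2) w(1) s sr this]
  have "uniform_limit {0..T} w u sequentially" by blast
  from uniform_limit_eventually_norm_less[OF this compact_Icc uc R(2)]
  obtain n0 where n0: "\<And>n. n \<ge> n0 \<Longrightarrow> \<forall>x\<in>{0..T}. norm (w n x) < R"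
    by (auto simp: eventually_sequentially)
  obtain n1 where n1: "R \<le> real n1" using real_arch_simple by blast
  define n where "n = max n0 n1"
  have small: "norm (w n x) < R" if "x \<in> {0..T}" for x using n0[of n] that by (auto simp: n_def)
  have "caratheodory_solution F {0..T} (w n)"
    by (rule truncated_solution_in_cball[OF w(1)]) (use small R in \<open>auto intro: less_imp_le\<close>)
  then have "w n (t (r n)) = v (r n) (t (r n))"
    using unique[of 0 T "w n" "v (r n)" "s (r n)" "t (r n)"] v s w(2) t(1) by blast
  then have "real (Suc (r n)) < R" using small[OF t(1), of "r n"] t(2)[of "r n"] by simp
  moreover have "n \<le> r n" using r by (rule strict_mono_imp_increasing)
  ultimately show False using n1 by (simp add: n_def)
qed

end

section \<open>Rotation\<close>

lemma absolutely_integrable_bilinear_continuous: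
  fixes h :: "'b::euclidean_space \<Rightarrow> 'c::euclidean_space \<Rightarrow> 'd::euclidean_space" and w :: "real \<Rightarrow> 'b"
  assumes "bilinear h" "continuous_on {a..b} w" "f absolutely_integrable_on {a..b}"
  shows "(\<lambda>t. h (w t) (f t)) absolutely_integrable_on {a..b}"
proof (rule absolutely_integrable_bounded_measurable_product[OF assms(1) _ _ _ assms(3)])
  show "w \<in> borel_measurable (lebesgue_on {a..b})"
    by (rule continuous_imp_measurable_on_sets_lebesgue[OF assms(2)]) simp
  show "bounded (w ` {a..b})"
    by (rule compact_imp_bounded[OF compact_continuous_image[OF assms(2) compact_Icc]])
qed simp

lemma bilinear_inner: "bilinear (inner :: 'a::euclidean_space \<Rightarrow> 'a \<Rightarrow> real)"
  by (simp add: bilinear_conv_bounded_bilinear bounded_bilinear_inner)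

lemma integral_increment_bound:
  fixes g :: "real \<Rightarrow> 'a::euclidean_space"
  assumes "g absolutely_integrable_on {a..b}" "a \<le> x" "x \<le> y" "y \<le> b"
    and "(g has_integral i) {x..y}"
  shows "norm i \<le> integral {x..y} (\<lambda>t. norm (g t))"
proof -
  have "g absolutely_integrable_on {x..y}"
    by (rule absolutely_integrable_on_subinterval[OF assms(1)]) (use assms in auto)
  then have "norm (integral {x..y} g) \<le> integral {x..y} (\<lambda>t. norm (g t))"
    using integral_norm_bound_integral[of g "{x..y}" "\<lambda>t. norm (g t)"] by (simp add: absolutely_integrable_on_def)
  then show ?thesis using assms(5) by (simp add: integral_unique)
qed

lemma has_integral_diff_initial:
  fixes g :: "real \<Rightarrow> 'a::euclidean_space"
  assumes "\<And>t. t \<in> {a..b} \<Longrightarrow> (g has_integral (u t - u a)) {a..t}" "a \<le> x" "x \<le> y" "y \<le> b"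
  shows "(g has_integral (u y - u x)) {x..y}"
proof -
  have y: "(g has_integral (u y - u a)) {a..y}" and x: "(g has_integral (u x - u a)) {a..x}"
    using assms by auto
  have i: "g integrable_on {x..y}"
    by (rule integrable_on_subinterval[OF has_integral_integrable[OF y]]) (use assms in auto)
  have "u x - u a + integral {x..y} g = u y - u a"
    using Henstock_Kurzweil_Integration.integral_combine[OF assms(2,3) has_integral_integrable[OF y]] x y
    by (auto simp: integral_unique)
  then have "integral {x..y} g = u y - u x" by (simp add: algebra_simps)
  then show ?thesis using integrable_integral[OF i] by simp
qed

lemma negligible_not_differentiable_integral:
  fixes g :: "real \<Rightarrow> 'a::euclidean_space"
  assumes "\<And>t. t \<in> {a..b} \<Longrightarrow> (g has_integral (u t - u a)) {a..t}" "a \<le> b"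
  obtains N where "negligible N"
    "\<And>t. t \<in> {a<..<b} \<Longrightarrow> t \<notin> N \<Longrightarrow> (u has_vector_derivative g t) (at t)"
proof -
  have "integral_solution (\<lambda>t _. g t) a b u"
    unfolding integral_solution_def using has_integral_diff_initial[OF assms(1)] by blast
  from integral_solution_imp_AE_derivative[OF this assms(2)] that show thesis
    unfolding eventually_ae_filter_negligible by blast
qed

lemma integral_solution_initial:
  "integral_solution F a b u \<Longrightarrow> t \<in> {a..b} \<Longrightarrow> ((\<lambda>t. F t (u t)) has_integral (u t - u a)) {a..t}"
  by (simp add: integral_solution_def)

text \<open>The half square of the norm is the coordinate \<open>\<rho>\<close>. Boundedness of
  \<open>u\<close> turns the integrable bound on its increments into one for those of
  \<open>\<rho>\<close>, as \<open>fundamental_theorem_of_calculus_AE\<close> requires.\<close>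

lemma has_integral_half_norm_square:
  fixes u :: "real \<Rightarrow> 'a::euclidean_space"
  assumes sol: "integral_solution F a b u" and ai: "(\<lambda>t. F t (u t)) absolutely_integrable_on {a..b}"
    and cont: "continuous_on {a..b} u" and xy: "a \<le> x" "x \<le> y" "y \<le> b"
  shows "((\<lambda>t. u t \<bullet> F t (u t)) has_integral ((norm (u y))\<^sup>2 / 2 - (norm (u x))\<^sup>2 / 2)) {x..y}"
proof -
  have ab: "a \<le> b" using xy by simp
  have "bounded (u ` {a..b})"
    by (rule compact_imp_bounded[OF compact_continuous_image[OF cont compact_Icc]])
  then obtain Z where Z: "Z > 0" "\<And>t. t \<in> {a..b} \<Longrightarrow> norm (u t) \<le> Z" unfolding bounded_pos by auto
  obtain N where N: "negligible N"
    "\<And>t. t \<in> {a<..<b} \<Longrightarrow> t \<notin> N \<Longrightarrow> (u has_vector_derivative F t (u t)) (at t)"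
    using negligible_not_differentiable_integral[OF integral_solution_initial[OF sol] ab] by metis
  have aixy: "(\<lambda>t. F t (u t)) absolutely_integrable_on {x..y}"
    by (rule absolutely_integrable_on_subinterval[OF ai]) (use xy in auto)
  then have ni: "(\<lambda>t. norm (F t (u t))) integrable_on {x..y}" by (simp add: absolutely_integrable_on_def)
  show ?thesis
  proof (rule fundamental_theorem_of_calculus_AE[OF xy(2) _ _ N(1)])
    show "(\<lambda>t. Z * norm (F t (u t))) integrable_on {x..y}"
      using integrable_on_cmult_left[OF ni, of Z] by simp
    fix v w assume vw: "x \<le> v" "v \<le> w" "w \<le> y"
    have "(norm (u w))\<^sup>2 / 2 - (norm (u v))\<^sup>2 / 2 = (u w + u v) \<bullet> (u w - u v) / 2"
      by (simp add: power2_norm_eq_inner inner_add_left inner_diff_right inner_commute[of "u v" "u w"])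
    then have "norm ((norm (u w))\<^sup>2 / 2 - (norm (u v))\<^sup>2 / 2) = \<bar>(u w + u v) \<bullet> (u w - u v)\<bar> / 2"
      by (simp only: real_norm_def abs_divide abs_numeral)
    also have "\<dots> \<le> norm (u w + u v) * norm (u w - u v) / 2"
      using Cauchy_Schwarz_ineq2 by (simp add: divide_right_mono)
    also have "\<dots> \<le> 2 * Z * norm (u w - u v) / 2"
      using norm_triangle_le[of "u w" "u v" "2 * Z"] Z(2)[of w] Z(2)[of v] vw xy
      by (intro divide_right_mono mult_right_mono) auto
    also have "\<dots> = Z * norm (u w - u v)" by simp
    also have "\<dots> \<le> Z * integral {v..w} (\<lambda>t. norm (F t (u t)))"
      using integral_increment_bound[OF ai, of v w] integral_solutionD[OF sol, of v w] vw xy Z(1)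
      by (intro mult_left_mono) auto
    also have "\<dots> = integral {v..w} (\<lambda>t. Z * norm (F t (u t)))" by simp
    finally show "norm ((norm (u w))\<^sup>2 / 2 - (norm (u v))\<^sup>2 / 2) \<le> integral {v..w} (\<lambda>t. Z * norm (F t (u t)))" .
  next
    fix t assume "t \<in> {x<..<y}" "t \<notin> N"
    then have d: "(u has_vector_derivative F t (u t)) (at t)" using N(2) xy by auto
    have "((\<lambda>t. u t \<bullet> u t) has_vector_derivative (u t \<bullet> F t (u t) + F t (u t) \<bullet> u t)) (at t)"
      by (rule bounded_bilinear.has_vector_derivative[OF bounded_bilinear_inner d d])
    then have "((\<lambda>t. u t \<bullet> u t / 2) has_vector_derivative (u t \<bullet> F t (u t) + F t (u t) \<bullet> u t) / 2) (at t)"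
      by (rule has_vector_derivative_divide)
    then show "((\<lambda>t. (norm (u t))\<^sup>2 / 2) has_vector_derivative u t \<bullet> F t (u t)) (at t)"
      by (simp add: power2_norm_eq_inner inner_commute)
  qed
qed

text \<open>The polar angle is thereby replaced by an integral, without choosing a branch of the
  argument: \<open>z' = (g / z) z\<close> is a linear equation, and with \<open>Q\<close> the
  integral of \<open>g / z\<close> the product \<open>z * exp (- Q)\<close> has derivative zero
  almost everywhere.\<close>

lemma exp_integral_quotient:
  fixes z g :: "real \<Rightarrow> complex"
  assumes ab: "a \<le> b" and ai: "g absolutely_integrable_on {a..b}"
    and z: "\<And>t. t \<in> {a..b} \<Longrightarrow> (g has_integral (z t - z a)) {a..t}"
    and nz: "\<And>t. t \<in> {a..b} \<Longrightarrow> z t \<noteq> 0"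
  shows "z b = z a * exp (integral {a..b} (\<lambda>t. g t / z t))"
proof -
  have gi: "g integrable_on {a..b}" using ai by (simp add: absolutely_integrable_on_def)
  have zeq: "z t = z a + integral {a..t} g" if "t \<in> {a..b}" for t using z[OF that] by (simp add: integral_unique)
  have "continuous_on {a..b} (\<lambda>t. z a + integral {a..t} g)"
    by (intro continuous_intros indefinite_integral_continuous_1 gi)
  then have zc: "continuous_on {a..b} z" by (rule continuous_on_eq) (rule zeq[symmetric])
  define q where "q t = g t / z t" for t
  have qeq: "q = (\<lambda>t. inverse (z t) * g t)" by (simp add: q_def fun_eq_iff field_simps)
  have qai: "q absolutely_integrable_on {a..b}" unfolding qeq
  proof (rule absolutely_integrable_bilinear_continuous[of "(*)" a b "\<lambda>t. inverse (z t)" g, OF _ _ ai])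
    show "bilinear ((*) :: complex \<Rightarrow> complex \<Rightarrow> complex)"
      using bounded_bilinear_mult bilinear_conv_bounded_bilinear by blast
    show "continuous_on {a..b} (\<lambda>t. inverse (z t))"
      by (intro continuous_on_inverse zc) (use nz in auto)
  qed
  then have qi: "q integrable_on {a..b}" by (simp add: absolutely_integrable_on_def)
  define Q where "Q t = integral {a..t} q" for t
  have Q: "(q has_integral (Q t - Q a)) {a..t}" if "t \<in> {a..b}" for t
  proof -
    have "q integrable_on {a..t}" by (rule integrable_on_subinterval[OF qi]) (use that in auto)
    then show ?thesis by (simp add: Q_def integrable_integral)
  qed
  have Qc: "continuous_on {a..b} Q" unfolding Q_def by (rule indefinite_integral_continuous_1[OF qi])
  have "bounded (z ` {a..b})" "bounded (Q ` {a..b})"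
    by (rule compact_imp_bounded[OF compact_continuous_image]; use zc Qc in auto)+
  then obtain Z B where Z: "Z > 0" "\<And>t. t \<in> {a..b} \<Longrightarrow> norm (z t) \<le> Z"
    and B: "B > 0" "\<And>t. t \<in> {a..b} \<Longrightarrow> norm (Q t) \<le> B" unfolding bounded_pos by auto
  have expB: "norm (exp w :: complex) \<le> exp B" if "norm w \<le> B" for w
    using that norm_exp[of w] by (meson exp_le_cancel_iff order_trans)
  \<comment> \<open>A Lipschitz bound for \<open>exp\<close> on a ball containing the values of
    \<open>- Q\<close> lets the increments of the product be dominated by an integral.\<close>
  have lip: "norm (exp w - exp w') \<le> exp B * norm (w - w')" if "norm w \<le> B" "norm w' \<le> B" for w w' :: complex
    by (rule field_differentiable_bound[of "cball 0 B" exp exp])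
      (use that expB in \<open>auto intro!: DERIV_exp[THEN DERIV_subset] simp: dist_norm\<close>)
  obtain N1 where N1: "negligible N1"
    "\<And>t. t \<in> {a<..<b} \<Longrightarrow> t \<notin> N1 \<Longrightarrow> (z has_vector_derivative g t) (at t)"
    using negligible_not_differentiable_integral[OF z ab] by metis
  obtain N2 where N2: "negligible N2"
    "\<And>t. t \<in> {a<..<b} \<Longrightarrow> t \<notin> N2 \<Longrightarrow> (Q has_vector_derivative q t) (at t)"
    using negligible_not_differentiable_integral[OF Q ab] by metis
  define u where "u t = z t * exp (- Q t)" for t
  have gn: "(\<lambda>t. norm (g t)) integrable_on {x..y}" and qn: "(\<lambda>t. norm (q t)) integrable_on {x..y}"
    if "a \<le> x" "y \<le> b" for x y
    using absolutely_integrable_on_subinterval[OF ai, of x y] absolutely_integrable_on_subinterval[OF qai, of x y] that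
    by (auto simp: absolutely_integrable_on_def)
  have "u b = u a"
  proof (rule has_vector_derivative_zero_AE_imp_eq[OF ab _ _ negligible_Un[OF N1(1) N2(1)]])
    show "(\<lambda>t. exp B * norm (g t) + Z * exp B * norm (q t)) integrable_on {a..b}"
      by (intro integrable_add integrable_on_cmult_left[where 'b = real, simplified] gn qn) auto
    fix x y assume xy: "a \<le> x" "x \<le> y" "y \<le> b"
    have 1: "norm (z y - z x) \<le> integral {x..y} (\<lambda>t. norm (g t))"
      by (rule integral_increment_bound[OF ai xy has_integral_diff_initial[OF z xy]])
    have 2: "norm (Q y - Q x) \<le> integral {x..y} (\<lambda>t. norm (q t))"
      by (rule integral_increment_bound[OF qai xy has_integral_diff_initial[OF Q xy]])
    have "u y - u x = (z y - z x) * exp (- Q y) + z x * (exp (- Q y) - exp (- Q x))"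
      by (simp add: u_def algebra_simps)
    then have "norm (u y - u x) \<le> norm (z y - z x) * norm (exp (- Q y)) + norm (z x) * norm (exp (- Q y) - exp (- Q x))"
      by (metis norm_mult norm_triangle_ineq)
    also have "\<dots> \<le> norm (z y - z x) * exp B + Z * (exp B * norm (- Q y - - Q x))"
      using xy Z B by (intro add_mono mult_mono expB lip mult_left_mono) auto
    also have "\<dots> = exp B * norm (z y - z x) + Z * exp B * norm (Q y - Q x)"
      by (simp add: norm_minus_commute)
    also have "\<dots> \<le> exp B * integral {x..y} (\<lambda>t. norm (g t)) + Z * exp B * integral {x..y} (\<lambda>t. norm (q t))"
      using 1 2 Z by (intro add_mono mult_left_mono) auto
    also have "\<dots> = integral {x..y} (\<lambda>t. exp B * norm (g t) + Z * exp B * norm (q t))"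
      using gn[of x y] qn[of x y] xy
      by (subst Henstock_Kurzweil_Integration.integral_add) (auto intro!: integrable_on_cmult_left[where 'b = real, simplified])
    finally show "norm (u y - u x) \<le> integral {x..y} (\<lambda>t. exp B * norm (g t) + Z * exp B * norm (q t))" .
  next
    fix t assume t: "t \<in> {a<..<b}" "t \<notin> N1 \<union> N2"
    have d1: "(z has_vector_derivative g t) (at t)" and d2: "((\<lambda>t. - Q t) has_vector_derivative - q t) (at t)"
      using N1(2)[of t] N2(2)[of t] t by (auto intro!: derivative_eq_intros)
    have "((exp \<circ> (\<lambda>t. - Q t)) has_vector_derivative (- q t * exp (- Q t))) (at t)"
      by (rule field_vector_diff_chain_at[OF d2 DERIV_exp])
    from has_vector_derivative_mult[OF d1 this]
    show "(u has_vector_derivative 0) (at t)"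
      unfolding u_def using nz[of t] t by (simp add: o_def q_def)
  qed
  then have "z b * exp (- Q b) = z a" by (simp add: u_def Q_def)
  then have "z b * exp (- Q b) * exp (Q b) = z a * exp (Q b)" by simp
  then show ?thesis by (simp add: exp_minus Q_def q_def[abs_def] field_simps)
qed

section \<open>Complex coordinates and the angular speed\<close>

definition cplx :: "real^2 \<Rightarrow> complex" where
  "cplx z = Complex (z $ 1) (z $ 2)"

lemma bounded_linear_cplx: "bounded_linear cplx"
  unfolding linear_conv_bounded_linear[symmetric] cplx_def
  by (rule linearI) (simp_all add: complex_eq_iff)

lemma norm_vec2: "(norm (z :: real^2))\<^sup>2 = (z $ 1)\<^sup>2 + (z $ 2)\<^sup>2"
  unfolding power2_norm_eq_inner inner_vec_def sum_2 by (simp add: power2_eq_square)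

lemma norm_cplx [simp]: "norm (cplx z) = norm z"
proof -
  have "(norm (cplx z))\<^sup>2 = (norm z)\<^sup>2" by (simp add: cplx_def cmod_power2 norm_vec2)
  then show ?thesis by simp
qed

lemma cplx_eq_iff: "cplx z = cplx w \<longleftrightarrow> z = w"
  by (simp add: cplx_def vec_eq_iff forall_2)

lemma symplectic_J_mult [simp]: "(symplectic_J *v z) $ 1 = z $ 2" "(symplectic_J *v z) $ 2 = - z $ 1"
  by (simp_all add: symplectic_J_def matrix_vector_mult_def sum_2)

lemma norm_symplectic_J [simp]: "norm (symplectic_J *v z) = norm z"
proof -
  have "(norm (symplectic_J *v z))\<^sup>2 = (norm z)\<^sup>2" by (simp add: norm_vec2)
  then show ?thesis by simp
qed

text \<open>The minus sign appears because \<open>symplectic_J *v z\<close> is \<open>z\<close>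
  turned clockwise, whereas the imaginary part measures counterclockwise speed.\<close>

lemma Im_cplx_divide: "Im (cplx f / cplx z) = - (f \<bullet> (symplectic_J *v z)) / (norm z)\<^sup>2"
  by (simp add: Im_divide cplx_def norm_vec2 inner_vec_def sum_2 algebra_simps)

text \<open>The clockwise angular speed at \<open>z\<close> of a motion with velocity \<open>f\<close>, regularised in the disc of radius
  \<open>\<delta>\<close>.\<close>

definition angular_speed :: "real \<Rightarrow> real^2 \<Rightarrow> real^2 \<Rightarrow> real" where
  "angular_speed \<delta> f z = (f \<bullet> (symplectic_J *v z)) / max ((norm z)\<^sup>2) (\<delta>\<^sup>2)"

text \<open>This bound, uniform in \<open>z\<close>, is what the regularisation buys: it supplies
  the dominating function for limits of the rotation and bounds the rotation inside a ball.\<close>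

lemma abs_angular_speed_le:
  assumes "\<delta> > 0"
  shows "\<bar>angular_speed \<delta> f z\<bar> \<le> norm f / \<delta>"
proof -
  have m: "max ((norm z)\<^sup>2) (\<delta>\<^sup>2) > 0" using assms by (simp add: less_max_iff_disj)
  have "norm z * \<delta> \<le> max ((norm z)\<^sup>2) (\<delta>\<^sup>2)"
  proof (cases "norm z \<le> \<delta>")
    case True
    then have "norm z * \<delta> \<le> \<delta>\<^sup>2" using assms by (simp add: power2_eq_square)
    then show ?thesis by simp
  next
    case False
    then have "norm z * \<delta> \<le> (norm z)\<^sup>2" by (simp add: power2_eq_square mult_left_mono)
    then show ?thesis by simp
  qed
  then have "norm f * norm z * \<delta> \<le> norm f * max ((norm z)\<^sup>2) (\<delta>\<^sup>2)"
    by (simp add: mult.assoc mult_left_mono)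
  moreover have "\<bar>f \<bullet> (symplectic_J *v z)\<bar> \<le> norm f * norm z"
    using Cauchy_Schwarz_ineq2[of f "symplectic_J *v z"] by simp
  ultimately have "\<bar>f \<bullet> (symplectic_J *v z)\<bar> * \<delta> \<le> norm f * max ((norm z)\<^sup>2) (\<delta>\<^sup>2)"
    using assms by (meson less_imp_le mult_right_mono order_trans)
  then show ?thesis using m assms by (simp add: angular_speed_def field_simps)
qed

lemma continuous_on_angular_direction:
  assumes "continuous_on S u" "\<delta> > 0"
  shows "continuous_on S (\<lambda>t. inverse (max ((norm (u t))\<^sup>2) (\<delta>\<^sup>2)) *\<^sub>R (symplectic_J *v u t))"
proof -
  have "max ((norm z)\<^sup>2) (\<delta>\<^sup>2) \<noteq> 0" for z :: "real^2"
    using assms(2) by (metis less_max_iff_disj less_numeral_extra(3) zero_less_power)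
  moreover have "continuous_on S (\<lambda>t. symplectic_J *v u t)"
    by (rule continuous_on_compose2[OF linear_continuous_on[OF matrix_vector_mul_bounded_linear] assms(1)]) auto
  ultimately show ?thesis using assms(1) by (intro continuous_intros) auto
qed

lemma angular_speed_eq_inner:
  "angular_speed \<delta> f z = (inverse (max ((norm z)\<^sup>2) (\<delta>\<^sup>2)) *\<^sub>R (symplectic_J *v z)) \<bullet> f"
  by (simp add: angular_speed_def inner_commute field_simps)

lemma angular_speed_absolutely_integrable:
  fixes f u :: "real \<Rightarrow> real^2"
  assumes "f absolutely_integrable_on {a..b}" "continuous_on {a..b} u" "\<delta> > 0"
  shows "(\<lambda>t. angular_speed \<delta> (f t) (u t)) absolutely_integrable_on {a..b}"
  unfolding angular_speed_eq_inner
  by (rule absolutely_integrable_bilinear_continuous[OF bilinear_inner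
        continuous_on_angular_direction[OF assms(2,3)] assms(1)])

lemma integral_mono_AE_lebesgue:
  fixes f g :: "real \<Rightarrow> real"
  assumes f: "f integrable_on S" and g: "g integrable_on S"
    and le: "AE t in lebesgue. t \<in> S \<longrightarrow> f t \<le> g t"
  shows "integral S f \<le> integral S g"
proof -
  obtain N where N: "negligible N" "{t. \<not> (t \<in> S \<longrightarrow> f t \<le> g t)} \<subseteq> N"
    using le unfolding eventually_ae_filter_negligible by blast
  define h where "h t = (if t \<in> N then f t else g t)" for t
  have "(h has_integral integral S g) S"
    by (rule has_integral_spike[OF N(1) _ integrable_integral[OF g]]) (simp add: h_def)
  moreover have "f t \<le> h t" if "t \<in> S" for t using N(2) that by (auto simp: h_def)
  ultimately show ?thesis by (rule has_integral_le[OF integrable_integral[OF f]])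
qed

section \<open>Rotation during one period\<close>

context planar_field
begin

text \<open>Meaningful for any continuous curve, even through the origin; it is the clockwise angle
  swept for a truncated solution that stays at distance at least \<open>\<delta>\<close> from the
  origin.\<close>

definition rotation :: "real \<Rightarrow> real \<Rightarrow> (real \<Rightarrow> real^2) \<Rightarrow> real" where
  "rotation R \<delta> u = integral {0..T} (\<lambda>t. angular_speed \<delta> (truncated R t (u t)) (u t))"

lemma truncated_AE_eq: "AE t in lebesgue. t \<in> {0..T} \<longrightarrow> (\<forall>z\<in>cball 0 R. truncated R t z = F t z)"
  using majorant(3)[of R] by eventually_elim (auto simp: truncated_def closest_point_self)

lemma truncated_compose_integrable:
  assumes "continuous_on {0..T} u" "R \<ge> 0"
  shows "(\<lambda>t. truncated R t (u t)) absolutely_integrable_on {0..T}"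
  by (rule bounded_caratheodory.compose_absolutely_integrable[OF truncated_bounded_caratheodory[OF assms(2)] assms(1)])

lemma rotation_integrable:
  assumes "continuous_on {0..T} u" "R \<ge> 0" "\<delta> > 0"
  shows "(\<lambda>t. angular_speed \<delta> (truncated R t (u t)) (u t)) integrable_on {0..T}"
  using angular_speed_absolutely_integrable[OF truncated_compose_integrable[OF assms(1,2)] assms(1,3)]
  by (simp add: absolutely_integrable_on_def)

lemma rotation_tendsto:
  assumes R: "R \<ge> 0" and \<delta>: "\<delta> > 0" and u: "\<And>n. continuous_on {0..T} (u n)"
    and lim: "\<And>t. t \<in> {0..T} \<Longrightarrow> (\<lambda>n. u n t) \<longlonglongrightarrow> v t"
  shows "(\<lambda>n. rotation R \<delta> (u n)) \<longlonglongrightarrow> rotation R \<delta> v"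
  unfolding rotation_def
proof (rule dominated_convergence(2))
  interpret bounded_caratheodory "truncated R" 0 T "majorant R"
    by (rule truncated_bounded_caratheodory[OF R])
  show "(\<lambda>t. angular_speed \<delta> (truncated R t (u n t)) (u n t)) integrable_on {0..T}" for n
    by (rule rotation_integrable[OF u R \<delta>])
  show "(\<lambda>t. majorant R t / \<delta>) integrable_on {0..T}"
    by (rule integrable_on_divide[OF m_integrable])
  show "norm (angular_speed \<delta> (truncated R t (u n t)) (u n t)) \<le> majorant R t / \<delta>" if "t \<in> {0..T}" for n t
    using abs_angular_speed_le[OF \<delta>, of "truncated R t (u n t)" "u n t"] bound[OF that, of "u n t"] \<delta>
    by (metis divide_right_mono less_imp_le order_trans real_norm_def)
  show "(\<lambda>n. angular_speed \<delta> (truncated R t (u n t)) (u n t)) \<longlonglongrightarrow> angular_speed \<delta> (truncated R t (v t)) (v t)"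
    if t: "t \<in> {0..T}" for t
  proof -
    have "continuous_on UNIV (\<lambda>z. angular_speed \<delta> (truncated R t z) z)"
      unfolding angular_speed_eq_inner
      by (intro continuous_on_inner cont continuous_on_angular_direction \<delta> continuous_on_id)
    from continuous_on_tendsto_compose[OF this lim[OF t]] show ?thesis by simp
  qed
qed

text \<open>The bound uses the majorant of the smaller radius \<open>R1\<close>, so it is the same
  for every truncation radius \<open>R\<close>; this allows the number of half turns to be fixed
  before \<open>R\<close>.\<close>

lemma abs_rotation_le:
  assumes R1: "0 \<le> R1" "R1 \<le> R" and \<delta>: "\<delta> > 0" and u: "continuous_on {0..T} u"
    and small: "\<And>t. t \<in> {0..T} \<Longrightarrow> norm (u t) \<le> R1"
  shows "\<bar>rotation R \<delta> u\<bar> \<le> integral {0..T} (\<lambda>t. majorant R1 t / \<delta>)"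
proof -
  have i: "(\<lambda>t. majorant R1 t / \<delta>) integrable_on {0..T}"
    using majorant(1)[of R1] by (intro integrable_on_divide) (simp add: absolutely_integrable_on_def)
  have ri: "(\<lambda>t. angular_speed \<delta> (truncated R t (u t)) (u t)) integrable_on {0..T}"
    by (rule rotation_integrable) (use assms in auto)
  have AE: "AE t in lebesgue. t \<in> {0..T} \<longrightarrow> \<bar>angular_speed \<delta> (truncated R t (u t)) (u t)\<bar> \<le> majorant R1 t / \<delta>"
    using truncated_AE_eq[of R] majorant(3)[of R1]
  proof eventually_elim
    case (elim t)
    show ?case
    proof
      assume t: "t \<in> {0..T}"
      then have "u t \<in> cball 0 R1" "u t \<in> cball 0 R" using small[OF t] R1 by auto
      then have "norm (truncated R t (u t)) \<le> majorant R1 t" using elim t by auto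
      then show "\<bar>angular_speed \<delta> (truncated R t (u t)) (u t)\<bar> \<le> majorant R1 t / \<delta>"
        using abs_angular_speed_le[OF \<delta>, of "truncated R t (u t)" "u t"] \<delta>
        by (meson divide_right_mono less_imp_le order_trans)
    qed
  qed
  have "rotation R \<delta> u \<le> integral {0..T} (\<lambda>t. majorant R1 t / \<delta>)"
    unfolding rotation_def by (rule integral_mono_AE_lebesgue[OF ri i]) (use AE in eventually_elim, auto)
  moreover have "integral {0..T} (\<lambda>t. - angular_speed \<delta> (truncated R t (u t)) (u t)) \<le> integral {0..T} (\<lambda>t. majorant R1 t / \<delta>)"
    by (rule integral_mono_AE_lebesgue[OF integrable_neg[OF ri] i]) (use AE in eventually_elim, auto)
  ultimately show ?thesis by (simp add: rotation_def)
qed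

text \<open>Outside the disc the regularisation is inactive, so the exponent in
  \<open>exp_integral_quotient\<close> has imaginary part \<open>- (2 N + 1) \<pi>\<close>, and the
  factor between \<open>u 0\<close> and \<open>u T\<close> is a negative real number.\<close>

lemma odd_half_turns:
  assumes sol: "integral_solution (truncated R) 0 T u" and R: "R \<ge> 0" and \<delta>: "\<delta> > 0"
    and away: "\<And>t. t \<in> {0..T} \<Longrightarrow> \<delta> \<le> norm (u t)"
    and rot: "rotation R \<delta> u = (2 * real N + 1) * pi"
  obtains l where "l > 0" "u T = - (l *\<^sub>R u 0)"
proof -
  interpret bounded_caratheodory "truncated R" 0 T "majorant R"
    by (rule truncated_bounded_caratheodory[OF R])
  let ?f = "\<lambda>t. truncated R t (u t)"
  have uc: "continuous_on {0..T} u" by (rule solution_continuous[OF sol])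
  have ai: "?f absolutely_integrable_on {0..T}" by (rule truncated_compose_integrable[OF uc R])
  have cai: "(\<lambda>t. cplx (?f t)) absolutely_integrable_on {0..T}"
    using absolutely_integrable_linear[OF ai bounded_linear_cplx] by (simp add: o_def)
  have nz: "cplx (u t) \<noteq> 0" if "t \<in> {0..T}" for t
    using away[OF that] \<delta> by (metis norm_cplx norm_zero not_le)
  let ?q = "\<lambda>t. cplx (?f t) / cplx (u t)"
  have eq: "cplx (u T) = cplx (u 0) * exp (integral {0..T} ?q)"
  proof (rule exp_integral_quotient[OF _ cai _ nz])
    show "((\<lambda>t. cplx (?f t)) has_integral cplx (u t) - cplx (u 0)) {0..t}" if "t \<in> {0..T}" for t
      using has_integral_linear[OF integral_solution_initial[OF sol that] bounded_linear_cplx]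
      by (simp add: o_def linear_diff[OF bounded_linear.linear[OF bounded_linear_cplx]])
  qed (use T in auto)
  have qi: "?q integrable_on {0..T}"
  proof -
    have "(\<lambda>t. inverse (cplx (u t)) * cplx (?f t)) absolutely_integrable_on {0..T}"
    proof (rule absolutely_integrable_bilinear_continuous[of "(*)" 0 T "\<lambda>t. inverse (cplx (u t))", OF _ _ cai])
      show "bilinear ((*) :: complex \<Rightarrow> complex \<Rightarrow> complex)"
        using bounded_bilinear_mult bilinear_conv_bounded_bilinear by blast
      have "continuous_on {0..T} (\<lambda>t. cplx (u t))"
        by (rule continuous_on_compose2[OF linear_continuous_on[OF bounded_linear_cplx] uc]) auto
      then show "continuous_on {0..T} (\<lambda>t. inverse (cplx (u t)))"
        by (rule continuous_on_inverse) (use nz in auto)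
    qed
    then have "(\<lambda>t. inverse (cplx (u t)) * cplx (?f t)) integrable_on {0..T}"
      by (simp add: absolutely_integrable_on_def)
    then show ?thesis by (simp add: divide_inverse mult.commute)
  qed
  have "Im (integral {0..T} ?q) = integral {0..T} (\<lambda>t. Im (?q t))"
    using integral_linear[OF qi bounded_linear_Im] by (simp add: o_def)
  also have "\<dots> = integral {0..T} (\<lambda>t. - angular_speed \<delta> (?f t) (u t))"
  proof (rule integral_cong)
    fix t assume t: "t \<in> {0..T}"
    have "\<delta>\<^sup>2 \<le> (norm (u t))\<^sup>2" using away[OF t] \<delta> by (intro power_mono) auto
    then show "Im (?q t) = - angular_speed \<delta> (?f t) (u t)"
      unfolding Im_cplx_divide by (simp add: angular_speed_def max_def)
  qed
  also have "\<dots> = - ((2 * real N + 1) * pi)" using rot by (simp add: rotation_def)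
  finally have Im: "Im (integral {0..T} ?q) = - ((2 * real N + 1) * pi)" .
  define l where "l = exp (Re (integral {0..T} ?q))"
  have "cos ((2 * real N + 1) * pi) = -1" "sin ((2 * real N + 1) * pi) = 0"
    using cos_npi[of "2 * N + 1"] sin_npi[of "2 * N + 1"] by (simp_all add: algebra_simps)
  then have "exp (integral {0..T} ?q) = - of_real l"
    by (simp add: complex_eq_iff Re_exp Im_exp Im l_def)
  then have "cplx (u T) = cplx (- (l *\<^sub>R u 0))"
    unfolding eq by (simp add: cplx_def complex_eq_iff)
  then have "u T = - (l *\<^sub>R u 0)" by (simp only: cplx_eq_iff)
  then show thesis using that[of l] by (simp add: l_def)
qed

end

section \<open>The fixed point\<close>

text \<open>The solutions of \<open>z = t f(z)\<close> with \<open>t\<close> in \<open>[0,1]\<close>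
  form a compact subset \<open>A\<close> of \<open>U\<close>. Multiplying \<open>f\<close> by a
  Urysohn function that is \<open>1\<close> on \<open>A\<close> and \<open>0\<close> off
  \<open>U\<close> gives a continuous map of the whole space into a ball. A Brouwer fixed point of
  it lies in \<open>A\<close>, where the factor is \<open>1\<close>.\<close>

theorem poincare_bohl:
  fixes f :: "'a::euclidean_space \<Rightarrow> 'a"
  assumes U: "open U" "bounded U" "0 \<in> U" and f: "continuous_on (closure U) f"
    and bdry: "\<And>z t. z \<in> closure U - U \<Longrightarrow> 0 \<le> t \<Longrightarrow> t \<le> 1 \<Longrightarrow> z \<noteq> t *\<^sub>R f z"
  shows "\<exists>z\<in>closure U. f z = z"
proof -
  have cU: "compact (closure U)" using U(2) by (simp add: compact_closure)
  define S where "S = {p \<in> {0..1} \<times> closure U. snd p = fst p *\<^sub>R f (snd p)}"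
  define A where "A = snd ` S"
  have "compact ({0..1::real} \<times> closure U)" by (rule compact_Times[OF compact_Icc cU])
  have cf: "continuous_on ({0..1::real} \<times> closure U) (\<lambda>p. f (snd p))"
    by (rule continuous_on_compose2[OF f continuous_on_snd[OF continuous_on_id]]) auto
  have "closed (({0..1} \<times> closure U) \<inter> (\<lambda>p. snd p - fst p *\<^sub>R f (snd p)) -` {0})"
    by (intro continuous_closed_preimage continuous_intros cf closed_Times) auto
  moreover have "S = ({0..1} \<times> closure U) \<inter> (\<lambda>p. snd p - fst p *\<^sub>R f (snd p)) -` {0}"
    by (auto simp: S_def)
  ultimately have "closed S" by simp
  have "S \<subseteq> {0..1} \<times> closure U" by (auto simp: S_def)
  then have "bounded S" using \<open>compact ({0..1} \<times> closure U)\<close> compact_imp_bounded bounded_subset by blast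
  then have "compact S" using \<open>closed S\<close> by (simp add: compact_eq_bounded_closed)
  then have "compact A" unfolding A_def by (rule compact_continuous_image[rotated]) (intro continuous_intros)
  then have "closed A" by (rule compact_imp_closed)
  have A_iff: "z \<in> A \<longleftrightarrow> z \<in> closure U \<and> (\<exists>t. 0 \<le> t \<and> t \<le> 1 \<and> z = t *\<^sub>R f z)" for z
    by (force simp: A_def S_def)
  have "A \<inter> - U = {}" using A_iff bdry by blast
  then obtain \<phi> :: "'a \<Rightarrow> real" where \<phi>: "continuous_on UNIV \<phi>" "\<And>x. \<phi> x \<in> closed_segment 1 0"
    "\<And>x. x \<in> A \<Longrightarrow> \<phi> x = 1" "\<And>x. x \<in> - U \<Longrightarrow> \<phi> x = 0"
    using Urysohn[OF \<open>closed A\<close>, of "- U" 1 0] U(1) by (metis closed_Compl)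
  have \<phi>01: "0 \<le> \<phi> x" "\<phi> x \<le> 1" for x using \<phi>(2)[of x] by (auto simp: closed_segment_eq_real_ivl)
  define g where "g z = (if z \<in> closure U then \<phi> z *\<^sub>R f z else 0)" for z
  have "continuous_on (closure U \<union> - U) g" unfolding g_def
  \<comment> \<open>The two closed pieces overlap on the boundary of \<open>U\<close>, where
    \<open>\<phi>\<close> vanishes.\<close>
  proof (rule continuous_on_cases)
    show "continuous_on (closure U) (\<lambda>z. \<phi> z *\<^sub>R f z)"
      by (intro continuous_intros f continuous_on_subset[OF \<phi>(1)]) auto
    show "\<forall>x. x \<in> closure U \<and> x \<notin> closure U \<or> x \<in> - U \<and> x \<in> closure U \<longrightarrow> \<phi> x *\<^sub>R f x = 0"
      using \<phi>(4) by auto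
  qed (use U(1) in auto)
  moreover have "closure U \<union> - U = UNIV" using closure_subset by blast
  ultimately have g: "continuous_on UNIV g" by simp
  obtain B where B: "B > 0" "\<And>z. z \<in> closure U \<Longrightarrow> norm (f z) \<le> B"
    using compact_imp_bounded[OF compact_continuous_image[OF f cU]] unfolding bounded_pos by auto
  have "norm (g z) \<le> B" for z
  proof (cases "z \<in> closure U")
    case True
    then have "norm (g z) = \<phi> z * norm (f z)" using \<phi>01 by (simp add: g_def)
    also have "\<dots> \<le> 1 * B" using \<phi>01 B True by (intro mult_mono) auto
    finally show ?thesis by simp
  qed (use B in \<open>simp add: g_def\<close>)
  then have "g \<in> cball 0 B \<rightarrow> cball 0 B" by auto
  then obtain z where z: "g z = z"
    using brouwer_ball[OF B(1) continuous_on_subset[OF g subset_UNIV]] by (metis Pi_iff image_subset_iff)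
  have zU: "z \<in> closure U"
    using z U(3) closure_subset by (metis g_def subsetD)
  then have eq: "z = \<phi> z *\<^sub>R f z" using z by (simp add: g_def)
  then have "z \<in> A" unfolding A_iff using zU \<phi>01 by blast
  then have "f z = z" using \<phi>(3) eq by (metis scaleR_one)
  with zU show ?thesis by blast
qed

section \<open>A priori bound and a periodic solution of the truncated system\<close>

context planar_field
begin

text \<open>\<open>M\<close> is fixed before the truncation radius \<open>R\<close>. By
  \<open>twist\<close> radial motion costs rotation, so the rotation controls the total variation of
  \<open>\<rho>\<close>; \<open>superlinear\<close> provides a time of small norm from which to
  measure it.\<close>

lemma a_priori_bound:
  assumes c: "c > 0" and r: "r > 0" and \<delta>: "\<delta> > 0"
    and twist: "AE t in lebesgue. t \<in> {0..T} \<longrightarrow> (\<forall>z. r \<le> norm z \<longrightarrow>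
      c * (\<bar>z \<bullet> F t z\<bar> - 1) \<le> (F t z \<bullet> (symplectic_J *v z)) / (norm z)\<^sup>2)"
    and superlinear: "\<And>B. \<exists>R. AE t in lebesgue. t \<in> {0..T} \<longrightarrow> (\<forall>z. R \<le> norm z \<longrightarrow>
      B \<le> (F t z \<bullet> (symplectic_J *v z)) / (norm z)\<^sup>2)"
  obtains M where "\<And>R u t. R \<ge> 0 \<Longrightarrow> integral_solution (truncated R) 0 T u \<Longrightarrow>
    (\<And>s. s \<in> {0..T} \<Longrightarrow> norm (u s) \<le> R) \<Longrightarrow> (\<And>s. s \<in> {0..T} \<Longrightarrow> \<delta> \<le> norm (u s)) \<Longrightarrow>
    rotation R \<delta> u \<le> C \<Longrightarrow> t \<in> {0..T} \<Longrightarrow> norm (u t) < M"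
proof -
  \<comment> \<open>\<open>n\<close> collects the possible defects: the additive \<open>c\<close> of
    \<open>twist\<close> beyond radius \<open>r\<close>, and within it the backward rotation
    \<open>majorant r t / \<delta>\<close> and the radial part
    \<open>c * r * majorant r t\<close>.\<close>
  define n where "n t = c + (1 / \<delta> + c * r) * majorant r t" for t
  have mi: "majorant r integrable_on {0..T}" using majorant(1)[of r] by (simp add: absolutely_integrable_on_def)
  have ni: "n integrable_on {0..T}" unfolding n_def
    by (intro integrable_add integrable_on_cmult_left[where 'b = real, simplified] mi) auto
  \<comment> \<open>A speed of at least \<open>(C + 1) / T\<close> throughout \<open>[0,T]\<close>
    would give rotation at least \<open>C + 1\<close>, so at some time the norm is below
    \<open>R'\<close>.\<close>
  obtain R' where R': "AE t in lebesgue. t \<in> {0..T} \<longrightarrow> (\<forall>z. R' \<le> norm z \<longrightarrow>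
      (C + 1) / T \<le> (F t z \<bullet> (symplectic_J *v z)) / (norm z)\<^sup>2)" using superlinear by blast
  define L where "L = (C + integral {0..T} n) / c"
  \<comment> \<open>The squared norm is below \<open>R'\<^sup>2\<close> at some time and varies by
    at most \<open>2 * L\<close>; the \<open>+ 1\<close> makes the bound strict.\<close>
  define M where "M = sqrt (\<bar>2 * L + R'\<^sup>2\<bar>) + 1"
  show thesis
  proof (rule that[of M])
    fix R u t assume R: "R \<ge> 0" and sol: "integral_solution (truncated R) 0 T u"
      and small: "\<And>s. s \<in> {0..T} \<Longrightarrow> norm (u s) \<le> R" and away: "\<And>s. s \<in> {0..T} \<Longrightarrow> \<delta> \<le> norm (u s)"
      and rot: "rotation R \<delta> u \<le> C" and t: "t \<in> {0..T}"
    interpret bounded_caratheodory "truncated R" 0 T "majorant R"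
      by (rule truncated_bounded_caratheodory[OF R])
    let ?f = "\<lambda>t. truncated R t (u t)"
    have uc: "continuous_on {0..T} u" by (rule solution_continuous[OF sol])
    have ai: "?f absolutely_integrable_on {0..T}" by (rule truncated_compose_integrable[OF uc R])
    have wi: "(\<lambda>t. angular_speed \<delta> (?f t) (u t)) integrable_on {0..T}"
      by (rule rotation_integrable[OF uc R \<delta>])
    have rad_ai: "(\<lambda>t. u t \<bullet> ?f t) absolutely_integrable_on {0..T}"
      by (rule absolutely_integrable_bilinear_continuous[OF bilinear_inner uc ai])
    then have rad: "(\<lambda>t. \<bar>u t \<bullet> ?f t\<bar>) integrable_on {0..T}"
      by (simp add: absolutely_integrable_on_def)
    have speed: "angular_speed \<delta> (?f s) (u s) = (?f s \<bullet> (symplectic_J *v u s)) / (norm (u s))\<^sup>2" if "s \<in> {0..T}" for s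
    proof -
      have "\<delta>\<^sup>2 \<le> (norm (u s))\<^sup>2" using away[OF that] \<delta> by (intro power_mono) auto
      then show ?thesis by (simp add: angular_speed_def max_def)
    qed
    have AE: "AE s in lebesgue. s \<in> {0..T} \<longrightarrow> c * \<bar>u s \<bullet> ?f s\<bar> - n s \<le> angular_speed \<delta> (?f s) (u s)"
      using truncated_AE_eq[of R] majorant(3)[of r] twist
    proof eventually_elim
      case (elim s)
      show ?case
      proof
        assume s: "s \<in> {0..T}"
        have fs: "?f s = F s (u s)" using elim s small[OF s] by auto
        have m0: "0 \<le> majorant r s" by (rule majorant)
        show "c * \<bar>u s \<bullet> ?f s\<bar> - n s \<le> angular_speed \<delta> (?f s) (u s)"
        proof (cases "r \<le> norm (u s)")
          case True
          have "angular_speed \<delta> (?f s) (u s) = (F s (u s) \<bullet> (symplectic_J *v u s)) / (norm (u s))\<^sup>2"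
            using speed[OF s] unfolding fs .
          then have "c * (\<bar>u s \<bullet> ?f s\<bar> - 1) \<le> angular_speed \<delta> (?f s) (u s)"
            unfolding fs using elim s True by simp
          moreover have "c \<le> n s" using m0 c r \<delta> by (simp add: n_def)
          ultimately show ?thesis by (simp add: algebra_simps)
        next
          case False
          then have us: "norm (u s) \<le> r" by simp
          then have fm: "norm (?f s) \<le> majorant r s" unfolding fs using elim s by auto
          have 1: "\<bar>angular_speed \<delta> (?f s) (u s)\<bar> \<le> majorant r s / \<delta>"
            using abs_angular_speed_le[OF \<delta>, of "?f s" "u s"] divide_right_mono[OF fm, of \<delta>] \<delta> by simp
          have "\<bar>u s \<bullet> ?f s\<bar> \<le> norm (u s) * norm (?f s)" by (rule Cauchy_Schwarz_ineq2)
          also have "\<dots> \<le> r * majorant r s" using us fm r by (intro mult_mono) auto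
          finally have "c * \<bar>u s \<bullet> ?f s\<bar> \<le> c * (r * majorant r s)" using c by (intro mult_left_mono) auto
          moreover have "n s = c + majorant r s / \<delta> + c * (r * majorant r s)" by (simp add: n_def algebra_simps)
          ultimately show ?thesis using 1 c by linarith
        qed
      qed
    qed
    have "integral {0..T} (\<lambda>s. c * \<bar>u s \<bullet> ?f s\<bar> - n s) \<le> rotation R \<delta> u"
      unfolding rotation_def
      by (rule integral_mono_AE_lebesgue[OF _ wi AE])
        (intro integrable_diff ni integrable_on_cmult_left[where 'b = real, simplified] rad)
    moreover have "integral {0..T} (\<lambda>s. c * \<bar>u s \<bullet> ?f s\<bar> - n s) = c * integral {0..T} (\<lambda>s. \<bar>u s \<bullet> ?f s\<bar>) - integral {0..T} n"
      by (subst Henstock_Kurzweil_Integration.integral_diff)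
        (auto intro: ni rad integrable_on_cmult_left[where 'b = real, simplified])
    ultimately have "c * integral {0..T} (\<lambda>s. \<bar>u s \<bullet> ?f s\<bar>) \<le> C + integral {0..T} n" using rot by simp
    then have var: "integral {0..T} (\<lambda>s. \<bar>u s \<bullet> ?f s\<bar>) \<le> L" using c by (simp add: L_def field_simps)
    have osc: "\<bar>(norm (u y))\<^sup>2 / 2 - (norm (u x))\<^sup>2 / 2\<bar> \<le> L" if xy: "0 \<le> x" "x \<le> y" "y \<le> T" for x y
    proof -
      have "norm ((norm (u y))\<^sup>2 / 2 - (norm (u x))\<^sup>2 / 2) \<le> integral {x..y} (\<lambda>s. norm (u s \<bullet> ?f s))"
        by (rule integral_increment_bound[OF rad_ai xy has_integral_half_norm_square[OF sol ai uc xy]])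
      also have "\<dots> \<le> integral {0..T} (\<lambda>s. norm (u s \<bullet> ?f s))"
      proof (rule integral_subset_le)
        show "(\<lambda>s. norm (u s \<bullet> ?f s)) integrable_on {x..y}"
          by (rule integrable_on_subinterval[of _ "{0..T}"]) (use rad xy in auto)
      qed (use rad xy in auto)
      finally show ?thesis using var by simp
    qed
    have "\<exists>s\<in>{0..T}. norm (u s) < R'"
    proof (rule ccontr)
      assume "\<not> (\<exists>s\<in>{0..T}. norm (u s) < R')"
      then have big: "R' \<le> norm (u s)" if "s \<in> {0..T}" for s using that by force
      have "AE s in lebesgue. s \<in> {0..T} \<longrightarrow> (C + 1) / T \<le> angular_speed \<delta> (?f s) (u s)"
        using truncated_AE_eq[of R] R'
      proof eventually_elim
        case (elim s)
        show ?case
        proof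
          assume s: "s \<in> {0..T}"
          then have fs: "?f s = F s (u s)" using elim small[OF s] by auto
          have "angular_speed \<delta> (?f s) (u s) = (F s (u s) \<bullet> (symplectic_J *v u s)) / (norm (u s))\<^sup>2"
            using speed[OF s] unfolding fs .
          then show "(C + 1) / T \<le> angular_speed \<delta> (?f s) (u s)"
            using elim s big[OF s] by simp
        qed
      qed
      then have "integral {0..T} (\<lambda>s. (C + 1) / T) \<le> rotation R \<delta> u"
        unfolding rotation_def by (intro integral_mono_AE_lebesgue wi) auto
      then show False using rot T by simp
    qed
    then obtain s where s: "s \<in> {0..T}" "norm (u s) < R'" by blast
    then have "(norm (u s))\<^sup>2 \<le> R'\<^sup>2" by (intro power_mono) auto
    moreover have "\<bar>(norm (u t))\<^sup>2 / 2 - (norm (u s))\<^sup>2 / 2\<bar> \<le> L"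
      using osc[of s t] osc[of t s] s(1) t by (cases "s \<le> t") (auto simp: abs_minus_commute)
    ultimately have "(norm (u t))\<^sup>2 \<le> \<bar>2 * L + R'\<^sup>2\<bar>" by linarith
    then have "norm (u t) \<le> sqrt \<bar>2 * L + R'\<^sup>2\<bar>" by (rule real_le_rsqrt)
    then show "norm (u t) < M" by (simp add: M_def)
  qed
qed

theorem truncated_periodic_solution:
  assumes zero: "\<And>s. s \<in> {0..T} \<Longrightarrow> \<exists>v. caratheodory_solution F {0..T} v \<and> v s = 0"
    and c: "c > 0" and r: "r > 0"
    and twist: "AE t in lebesgue. t \<in> {0..T} \<longrightarrow> (\<forall>z. r \<le> norm z \<longrightarrow>
      c * (\<bar>z \<bullet> F t z\<bar> - 1) \<le> (F t z \<bullet> (symplectic_J *v z)) / (norm z)\<^sup>2)"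
    and superlinear: "\<And>B. \<exists>R. AE t in lebesgue. t \<in> {0..T} \<longrightarrow> (\<forall>z. R \<le> norm z \<longrightarrow>
      B \<le> (F t z \<bullet> (symplectic_J *v z)) / (norm z)\<^sup>2)"
  obtains R u where "R \<ge> 0" "integral_solution (truncated R) 0 T u"
    "\<And>t. t \<in> {0..T} \<Longrightarrow> norm (u t) \<le> R" "u T = u 0"
proof -
  obtain \<delta> R1 where \<delta>: "\<delta> > 0" and R1: "R1 > 0" and near:
    "\<And>v s t. caratheodory_solution F {0..T} v \<Longrightarrow> s \<in> {0..T} \<Longrightarrow> norm (v s) \<le> \<delta> \<Longrightarrow> t \<in> {0..T} \<Longrightarrow> norm (v t) < R1"
    using solutions_near_origin_bounded[OF zero] by metis
  define C1 where "C1 = integral {0..T} (\<lambda>t. majorant R1 t / \<delta>)"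
  obtain N where N: "C1 < real N" using reals_Archimedean2 by blast
  define C where "C = (2 * real N + 1) * pi"
  have "real N * 1 \<le> (2 * real N + 1) * pi" using pi_gt3 by (intro mult_mono) auto
  then have C1C: "C1 < C" using N by (simp add: C_def)
  obtain M where M: "\<And>R u t. R \<ge> 0 \<Longrightarrow> integral_solution (truncated R) 0 T u \<Longrightarrow>
    (\<And>s. s \<in> {0..T} \<Longrightarrow> norm (u s) \<le> R) \<Longrightarrow> (\<And>s. s \<in> {0..T} \<Longrightarrow> \<delta> \<le> norm (u s)) \<Longrightarrow>
    rotation R \<delta> u \<le> C \<Longrightarrow> t \<in> {0..T} \<Longrightarrow> norm (u t) < M"
    using a_priori_bound[OF c r \<delta> twist superlinear] by metis
  define R where "R = max R1 M"
  have R: "R \<ge> 0" "R1 \<le> R" "M \<le> R" using R1 by (auto simp: R_def)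
  interpret bounded_caratheodory "truncated R" 0 T "majorant R"
    by (rule truncated_bounded_caratheodory[OF R(1)])
  have T0: "0 \<in> {0..T}" "T \<in> {0..T}" using T by auto
  define Sol where "Sol u \<longleftrightarrow> integral_solution (truncated R) 0 T u" for u
  \<comment> \<open>An arbitrary choice among possibly several truncated solutions;
    \<open>truncated_unique\<close> shows that there is only one wherever the chosen one stays
    strictly inside the ball.\<close>
  define sol where "sol z = (SOME u. Sol u \<and> u 0 = z)" for z
  have sol: "Sol (sol z)" "sol z 0 = z" for z
    using someI_ex[OF peano_existence[OF T0(1), of z], folded Sol_def] by (auto simp: sol_def)
  have Sol_car: "caratheodory_solution F {0..T} u" if "Sol u" "\<And>t. t \<in> {0..T} \<Longrightarrow> norm (u t) < R" for u
    by (rule truncated_solution_in_cball[OF that(1)[unfolded Sol_def] R(1)]) (use that(2) in \<open>auto intro: less_imp_le\<close>)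
  have Sol_cont: "continuous_on {0..T} u" if "Sol u" for u
    using solution_continuous that by (simp add: Sol_def)
  have small_rot: "\<bar>rotation R \<delta> u\<bar> \<le> C1" if "Sol u" "\<And>t. t \<in> {0..T} \<Longrightarrow> norm (u t) < R1" for u
    unfolding C1_def by (rule abs_rotation_le) (use R1 R \<delta> Sol_cont that in \<open>auto intro: less_imp_le\<close>)
  \<comment> \<open>A solution confined to the closed ball with rotation at most \<open>C\<close>
    stays in the open one: by \<open>near\<close> if it meets the disc, by \<open>M\<close>
    otherwise. So in a limit of points of \<open>U\<close> the norm condition cannot be
    lost.\<close>
  have bound_R: "norm (u t) < R"
    if "Sol u" "\<And>t. t \<in> {0..T} \<Longrightarrow> norm (u t) \<le> R" "rotation R \<delta> u \<le> C" "t \<in> {0..T}" for u t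
  proof (cases "\<exists>s\<in>{0..T}. norm (u s) \<le> \<delta>")
    case True
    have "caratheodory_solution F {0..T} u"
      using truncated_solution_in_cball[OF that(1)[unfolded Sol_def] R(1) that(2)] .
    with True near that(4) have "norm (u t) < R1" by blast
    then show ?thesis using R by simp
  next
    case False
    then have "\<delta> \<le> norm (u s)" if "s \<in> {0..T}" for s using that by force
    then have "norm (u t) < M" using M[OF R(1) that(1)[unfolded Sol_def] that(2) _ that(3,4)] by blast
    then show ?thesis using R by simp
  qed
  define U where "U = {z. (\<forall>t\<in>{0..T}. norm (sol z t) < R) \<and> rotation R \<delta> (sol z) < C}"
  \<comment> \<open>Candidate to contain the closure: only the inequality for the rotation is
    relaxed.\<close>
  define V where "V = {z. (\<forall>t\<in>{0..T}. norm (sol z t) < R) \<and> rotation R \<delta> (sol z) \<le> C}"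
  have dep: "uniform_limit {0..T} (\<lambda>n. sol (x n)) (sol z) sequentially" if "z \<in> V" "x \<longlonglongrightarrow> z" for x z
  proof (rule truncated_dependence[where s = "\<lambda>_. 0" and s' = 0])
    show "norm (sol z t) < R" if "t \<in> {0..T}" for t using \<open>z \<in> V\<close> that by (simp add: V_def)
    then show "caratheodory_solution F {0..T} (sol z)" by (intro Sol_car sol)
  qed (use that T0 sol in \<open>auto simp: Sol_def\<close>)
  have rot_lim: "(\<lambda>n. rotation R \<delta> (sol (x n))) \<longlonglongrightarrow> rotation R \<delta> v"
    if "uniform_limit {0..T} (\<lambda>n. sol (x n)) v sequentially" for x v
    by (rule rotation_tendsto[OF R(1) \<delta> Sol_cont[OF sol(1)] tendsto_uniform_limitI[OF that]])
  have UV: "closure U \<subseteq> V"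
  proof
    fix z assume "z \<in> closure U"
    then obtain x where x: "\<And>n. x n \<in> U" "x \<longlonglongrightarrow> z" unfolding closure_sequential by blast
    have xR: "norm (sol (x n) t) < R" if "t \<in> {0..T}" for n t using x(1) that by (simp add: U_def)
    \<comment> \<open>The limit is found by compactness, since \<open>dep\<close> presupposes that
      \<open>sol z\<close> stays inside. It is first confined to the closed ball, then to the open
      one by \<open>bound_R\<close>, and only then identified with \<open>sol z\<close>.\<close>
    obtain v q where v: "Sol v" and q: "strict_mono (q :: nat \<Rightarrow> nat)"
      and ul: "uniform_limit {0..T} (\<lambda>n. sol (x (q n))) v sequentially"
      using solution_compactness[of "\<lambda>n. sol (x n)" "\<lambda>_. 0" R] sol xR[OF T0(1)] T0 unfolding Sol_def
      by (metis less_imp_le)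
    have lim: "(\<lambda>n. sol (x (q n)) t) \<longlonglongrightarrow> v t" if "t \<in> {0..T}" for t
      by (rule tendsto_uniform_limitI[OF ul that])
    have vR: "norm (v t) \<le> R" if "t \<in> {0..T}" for t
      by (rule LIMSEQ_le_const2[OF tendsto_norm[OF lim[OF that]]]) (use xR[OF that] in \<open>auto intro: less_imp_le\<close>)
    have vC: "rotation R \<delta> v \<le> C"
      by (rule LIMSEQ_le_const2[OF rot_lim[OF ul]]) (use x(1) in \<open>auto simp: U_def intro: less_imp_le\<close>)
    have vless: "norm (v t) < R" if "t \<in> {0..T}" for t by (rule bound_R[OF v vR vC that])
    have "(\<lambda>n. x (q n)) \<longlonglongrightarrow> v 0" using lim[OF T0(1)] by (simp add: sol)
    then have "v 0 = z" using LIMSEQ_subseq_LIMSEQ[OF x(2) q] LIMSEQ_unique by (fastforce simp: o_def)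
    have eq: "sol z t = v t" if "t \<in> {0..T}" for t
      using truncated_unique[OF Sol_car[OF v vless] vless sol(1)[unfolded Sol_def] T0(1) _ that, of z] \<open>v 0 = z\<close>
      by (simp add: sol)
    have "rotation R \<delta> (sol z) = rotation R \<delta> v"
      unfolding rotation_def by (rule integral_cong) (simp only: eq)
    then show "z \<in> V" using eq vless vC by (simp add: V_def)
  qed
  have near_R1: "z \<in> U" if "Sol u" "\<And>t. t \<in> {0..T} \<Longrightarrow> norm (u t) < R1" "sol z = u" for u z
    using small_rot[OF that(1,2)] that C1C R(2) by (force simp: U_def)
  have "closed (- U)"
    unfolding closed_sequential_limits
  proof (intro allI impI, elim conjE)
    fix x z assume x: "\<forall>n. x n \<in> - U" "x \<longlonglongrightarrow> z"
    show "z \<in> - U"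
    proof
      assume z: "z \<in> U"
      then have zV: "z \<in> V" by (auto simp: U_def V_def)
      note ul = dep[OF zV x(2)]
      have "\<forall>\<^sub>F n in sequentially. \<forall>t\<in>{0..T}. norm (sol (x n) t) < R"
        by (rule uniform_limit_eventually_norm_less[OF ul compact_Icc Sol_cont[OF sol(1)]])
          (use z in \<open>simp add: U_def\<close>)
      moreover have "\<forall>\<^sub>F n in sequentially. rotation R \<delta> (sol (x n)) < C"
        using order_tendstoD(2)[OF rot_lim[OF ul]] z by (simp add: U_def)
      ultimately have "\<forall>\<^sub>F n in sequentially. x n \<in> U"
        by eventually_elim (simp add: U_def)
      then show False using x(1) by (auto simp: eventually_sequentially)
    qed
  qed
  then have oU: "open U" by (simp add: open_closed)
  have bU: "bounded U"
  proof (rule boundedI)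
    fix z assume "z \<in> U"
    then have "norm (sol z 0) < R" using T0(1) by (simp add: U_def)
    then show "norm z \<le> R" by (simp add: sol)
  qed
  have "0 \<in> U"
  proof -
    obtain v where v: "caratheodory_solution F {0..T} v" "v 0 = 0" using zero[OF T0(1)] by blast
    have vR1: "norm (v t) < R1" if "t \<in> {0..T}" for t
      by (rule near[OF v(1) T0(1) _ that]) (use v \<delta> in simp)
    have "norm (v t) < R" if "t \<in> {0..T}" for t using vR1[OF that] R by simp
    from truncated_unique[OF v(1) this sol(1)[unfolded Sol_def] T0(1)] v(2)
    have "sol 0 t = v t" if "t \<in> {0..T}" for t using that by (simp add: sol)
    then show ?thesis using vR1 by (intro near_R1[OF sol(1)]) auto
  qed
  define P where "P z = sol z T" for z
  have cP: "continuous_on (closure U) P"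
    unfolding continuous_on_sequentially
  proof (intro allI ballI impI, elim conjE)
    fix x z assume "z \<in> closure U" "x \<longlonglongrightarrow> z"
    then show "(P \<circ> x) \<longlonglongrightarrow> P z"
      using tendsto_uniform_limitI[OF dep T0(2)] UV by (auto simp: P_def o_def)
  qed
  have bdry: "z \<noteq> t *\<^sub>R P z" if z: "z \<in> closure U - U" and t: "0 \<le> t" "t \<le> 1" for z t
  proof
    assume eq: "z = t *\<^sub>R P z"
    have zV: "z \<in> V" using z UV by blast
    then have zR: "norm (sol z t) < R" if "t \<in> {0..T}" for t using that by (simp add: V_def)
    have rot: "rotation R \<delta> (sol z) = C" using zV z by (auto simp: U_def V_def)
    \<comment> \<open>A curve meeting the disc stays in the ball of radius \<open>R1\<close>, where
      its rotation is below \<open>C\<close>, so its initial value would lie in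
      \<open>U\<close>.\<close>
    have away: "\<delta> < norm (sol z s)" if "s \<in> {0..T}" for s
    proof (rule ccontr)
      assume "\<not> \<delta> < norm (sol z s)"
      then have "norm (sol z t) < R1" if "t \<in> {0..T}" for t
        using near[OF Sol_car[OF sol(1) zR] \<open>s \<in> {0..T}\<close> _ that] by simp
      then show False using near_R1[OF sol(1) _ refl] z by blast
    qed
    obtain l where l: "l > 0" "sol z T = - (l *\<^sub>R sol z 0)"
      using odd_half_turns[OF sol(1)[unfolded Sol_def] R(1) \<delta> less_imp_le[OF away] rot[unfolded C_def]] by blast
    \<comment> \<open>A point that is minus a nonnegative multiple of itself vanishes, yet the curve
      starts outside the disc.\<close>
    have "z = - ((t * l) *\<^sub>R z)" using eq l(2) by (simp add: P_def sol)
    then have "(1 + t * l) *\<^sub>R z = 0" unfolding eq_neg_iff_add_eq_0 by (simp add: scaleR_left_distrib)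
    moreover have "1 + t * l > 0" using t l(1) by (simp add: add_pos_nonneg)
    ultimately have "z = 0" by simp
    then show False using away[OF T0(1)] \<delta> by (simp add: sol)
  qed
  obtain z where z: "z \<in> closure U" "P z = z"
    using poincare_bohl[OF oU bU \<open>0 \<in> U\<close> cP bdry] by blast
  show thesis
  proof (rule that[OF R(1)])
    show "integral_solution (truncated R) 0 T (sol z)" using sol(1) by (simp add: Sol_def)
    show "norm (sol z t) \<le> R" if "t \<in> {0..T}" for t
      using z(1) UV that by (force simp: V_def)
    show "sol z T = sol z 0" using z(2) by (simp add: P_def sol)
  qed
qed

end

section \<open>Polar coordinates\<close>

lemma GDERIV_gradient:
  fixes f :: "'a::euclidean_space \<Rightarrow> real"
  assumes "f differentiable (at z)"
  shows "GDERIV f z :> gradient f z"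
proof -
  obtain f' where f': "(f has_derivative f') (at z)" using assms by (auto simp: differentiable_def)
  then have lin: "linear f'" by (rule has_derivative_linear)
  define D where "D = (\<Sum>b\<in>Basis. f' b *\<^sub>R b)"
  have "f' h = h \<bullet> D" for h
  proof -
    have "f' h = f' (\<Sum>b\<in>Basis. (h \<bullet> b) *\<^sub>R b)" by (simp add: euclidean_representation)
    also have "\<dots> = (\<Sum>b\<in>Basis. (h \<bullet> b) * f' b)" by (simp add: linear_sum[OF lin] linear_scale[OF lin])
    also have "\<dots> = h \<bullet> D" by (simp add: D_def inner_sum_right mult.commute)
    finally show ?thesis .
  qed
  then have "f' = (\<lambda>h. h \<bullet> D)" by (rule ext)
  then have D: "GDERIV f z :> D" using f' by (simp add: gderiv_def)
  have "gradient f z = D" unfolding gradient_def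
  proof (rule the_equality[of "\<lambda>D. GDERIV f z :> D" D, OF D])
    fix E assume "GDERIV f z :> E"
    then have "(\<lambda>h. h \<bullet> E) = (\<lambda>h. h \<bullet> D)"
      using D unfolding gderiv_def by (rule has_derivative_unique)
    then have "h \<bullet> E = h \<bullet> D" for h by metis
    then show "E = D" by (metis inner_commute vector_eq_rdot)
  qed
  with D show ?thesis by simp
qed

lemma DERIV_compose_gradient:
  fixes f :: "'a::euclidean_space \<Rightarrow> real"
  assumes "f differentiable (at (g x))" "(g has_vector_derivative g') (at x)"
  shows "((\<lambda>x. f (g x)) has_real_derivative (g' \<bullet> gradient f (g x))) (at x)"
proof -
  have "(f has_derivative (\<lambda>h. h \<bullet> gradient f (g x))) (at (g x))"
    using GDERIV_gradient[OF assms(1)] by (simp add: gderiv_def)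
  from diff_chain_at[OF assms(2)[unfolded has_vector_derivative_def] this]
  show ?thesis by (simp add: has_field_derivative_def o_def mult.commute[of _ "g' \<bullet> gradient f (g x)"] cong: if_cong)
qed

lemma polar_components: "polar \<theta> \<rho> $ 1 = sqrt (2 * \<rho>) * cos \<theta>" "polar \<theta> \<rho> $ 2 = - (sqrt (2 * \<rho>) * sin \<theta>)"
  by (simp_all add: polar_def)

lemma norm_polar: "\<rho> \<ge> 0 \<Longrightarrow> (norm (polar \<theta> \<rho>))\<^sup>2 = 2 * \<rho>"
  unfolding norm_vec2 polar_components
  by (simp add: power_mult_distrib distrib_left[symmetric] flip: add_divide_distrib)

lemma polar_surj:
  assumes "z \<noteq> 0"
  obtains \<theta> where "\<theta> \<in> {0..<2 * pi}" "z = polar \<theta> ((norm z)\<^sup>2 / 2)"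
proof -
  have n: "norm z > 0" using assms by simp
  have "(z $ 1 / norm z)\<^sup>2 + (- z $ 2 / norm z)\<^sup>2 = 1"
    unfolding power_divide power2_minus add_divide_distrib[symmetric] norm_vec2[symmetric] using n by simp
  from sincos_total_2pi[OF this] obtain \<theta> where \<theta>: "0 \<le> \<theta>" "\<theta> < 2 * pi"
    "z $ 1 / norm z = cos \<theta>" "- z $ 2 / norm z = sin \<theta>" .
  then have "z $ 1 = norm z * cos \<theta>" "z $ 2 = - (norm z * sin \<theta>)" using n by (auto simp: field_simps)
  then have "z = polar \<theta> ((norm z)\<^sup>2 / 2)"
    unfolding vec_eq_iff forall_2 polar_components by (simp add: real_sqrt_abs)
  with \<theta> that show thesis by simp
qed

lemma polar_eq: "polar \<theta> \<rho> = sqrt (2 * \<rho>) *\<^sub>R (cos \<theta> *\<^sub>R axis 1 1 - sin \<theta> *\<^sub>R axis 2 1)"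
  unfolding vec_eq_iff forall_2 polar_components by (simp add: axis_def)

lemma polar_derivative_radius:
  assumes "\<rho> > 0"
  shows "((\<lambda>\<rho>. polar \<theta> \<rho>) has_vector_derivative (1 / (2 * \<rho>)) *\<^sub>R polar \<theta> \<rho>) (at \<rho>)"
proof -
  have "((\<lambda>\<rho>. sqrt (2 * \<rho>)) has_real_derivative (sqrt (2 * \<rho>) / (2 * \<rho>))) (at \<rho>)"
    using assms by (auto intro!: derivative_eq_intros simp: field_simps real_sqrt_mult_self)
  from has_vector_derivative_scaleR[OF this has_vector_derivative_const,
      of "cos \<theta> *\<^sub>R axis 1 1 - sin \<theta> *\<^sub>R axis 2 1 :: real^2"]
  show ?thesis unfolding polar_eq by simp
qed

lemma polar_derivative_angle:
  "((\<lambda>\<theta>. polar \<theta> \<rho>) has_vector_derivative symplectic_J *v polar \<theta> \<rho>) (at \<theta>)"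
proof -
  have "symplectic_J *v polar \<theta> \<rho> = sqrt (2 * \<rho>) *\<^sub>R ((- sin \<theta>) *\<^sub>R axis 1 1 - cos \<theta> *\<^sub>R axis 2 1)"
    unfolding vec_eq_iff forall_2 by (simp add: polar_components axis_def)
  then show ?thesis unfolding polar_eq
    by (auto intro!: derivative_eq_intros)
qed

text \<open>These are Hamilton's equations in the canonical coordinates: the clockwise speed is the
  derivative in \<open>\<rho>\<close>, and the rate of \<open>\<rho>\<close> is minus the derivative
  in \<open>\<theta>\<close>. They turn (H1) and (H2) into inequalities for the field. The first one
  includes differentiability, from which growth along rays is derived.\<close>

lemma deriv_polar_H:
  fixes \<rho> \<theta> :: real
  assumes H: "\<And>z. H t differentiable (at z)" and \<rho>: "\<rho> > 0"
  defines "z \<equiv> polar \<theta> \<rho>"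
  shows "((\<lambda>\<rho>'. polar_H H t \<theta> \<rho>') has_real_derivative
      (hamiltonian_field H t z \<bullet> (symplectic_J *v z)) / (norm z)\<^sup>2) (at \<rho>)"
    and "deriv (\<lambda>\<theta>'. polar_H H t \<theta>' \<rho>) \<theta> = - (z \<bullet> hamiltonian_field H t z)"
proof -
  have nz: "(norm z)\<^sup>2 = 2 * \<rho>" using norm_polar[of \<rho> \<theta>] \<rho> by (simp add: z_def)
  have "hamiltonian_field H t z \<bullet> (symplectic_J *v z) = z \<bullet> gradient (H t) z"
    by (simp add: hamiltonian_field_def inner_vec_def sum_2)
  then have "((1 / (2 * \<rho>)) *\<^sub>R z) \<bullet> gradient (H t) z =
      (hamiltonian_field H t z \<bullet> (symplectic_J *v z)) / (norm z)\<^sup>2"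
    by (simp add: nz)
  then show "((\<lambda>\<rho>'. polar_H H t \<theta> \<rho>') has_real_derivative
      (hamiltonian_field H t z \<bullet> (symplectic_J *v z)) / (norm z)\<^sup>2) (at \<rho>)"
    using DERIV_compose_gradient[OF H polar_derivative_radius[OF \<rho>, of \<theta>]]
    by (simp add: polar_H_def z_def)
  have "(symplectic_J *v z) \<bullet> gradient (H t) z = - (z \<bullet> hamiltonian_field H t z)"
    by (simp add: hamiltonian_field_def inner_vec_def sum_2)
  then show "deriv (\<lambda>\<theta>'. polar_H H t \<theta>' \<rho>) \<theta> = - (z \<bullet> hamiltonian_field H t z)"
    using DERIV_imp_deriv[OF DERIV_compose_gradient[OF H polar_derivative_angle[of \<rho> \<theta>]]]
    by (simp add: polar_H_def z_def)
qed

text \<open>This replaces the power in (H1) by the case \<open>\<gamma> = 1\<close>, at the cost of an additive constant.\<close>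

lemma powr_ge_minus_one:
  fixes x \<gamma> :: real
  assumes "0 \<le> x" "1 \<le> \<gamma>"
  shows "x - 1 \<le> x powr \<gamma>"
proof (cases "x \<le> 1")
  case True
  then show ?thesis using powr_ge_zero[of x \<gamma>] by linarith
next
  case False
  then have "x powr 1 \<le> x powr \<gamma>" using assms by (intro powr_mono) auto
  then show ?thesis using False by simp
qed

text \<open>The quantity \<open>h s * s powr (- 1 / (2 * k))\<close> is nondecreasing.\<close>

lemma superquadratic_growth:
  fixes h h' :: "real \<Rightarrow> real"
  assumes r: "r > 0" and k: "0 < k" and m: "m > 0"
    and d: "\<And>s. r \<le> s \<Longrightarrow> (h has_real_derivative h' s) (at s)"
    and lo: "\<And>s. r \<le> s \<Longrightarrow> m \<le> h s" and up: "\<And>s. r \<le> s \<Longrightarrow> h s \<le> 2 * k * s * h' s"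
    and s: "r \<le> s"
  shows "m * r powr (- (1 / (2 * k))) / (2 * k) * s powr (1 / (2 * k) - 1) \<le> h' s"
proof -
  define q where "q = 1 / (2 * k)"
  have q: "q > 0" using k by (simp add: q_def)
  have qh: "q * h x \<le> x * h' x" if "r \<le> x" for x
    using up[OF that] k by (simp add: q_def field_simps)
  have "h r * r powr (- q) \<le> h s * s powr (- q)"
  proof (rule DERIV_nonneg_imp_nondecreasing[OF s])
    fix x assume x: "r \<le> x" "x \<le> s"
    then have x0: "x > 0" using r by simp
    have "((\<lambda>x. h x * x powr (- q)) has_real_derivative
        (h' x * x powr (- q) + (- q * x powr (- q - 1)) * h x)) (at x)"
      by (rule DERIV_mult[OF d[OF x(1)] has_real_derivative_powr[OF x0]])
    moreover have "h' x * x powr (- q) + (- q * x powr (- q - 1)) * h x = x powr (- q - 1) * (x * h' x - q * h x)"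
    proof -
      have "x powr (- q) = x powr (- q - 1) * x" using x0 powr_add[of x "- q - 1" 1] by simp
      then show ?thesis by (simp add: algebra_simps)
    qed
    moreover have "0 \<le> x powr (- q - 1) * (x * h' x - q * h x)" using qh[OF x(1)] by simp
    ultimately show "\<exists>y. ((\<lambda>x. h x * x powr (- q)) has_real_derivative y) (at x) \<and> 0 \<le> y"
      by metis
  qed
  moreover have "m * r powr (- q) \<le> h r * r powr (- q)" using lo[of r] by (intro mult_right_mono) auto
  ultimately have "m * r powr (- q) \<le> h s * s powr (- q)" by linarith
  then have "m * r powr (- q) * s powr q \<le> h s * s powr (- q) * s powr q" by (intro mult_right_mono) auto
  also have "\<dots> = h s" using r s by (simp add: powr_minus field_simps)
  finally have "q * (m * r powr (- q) * s powr q) \<le> q * h s" using q by (intro mult_left_mono) auto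
  also have "\<dots> \<le> s * h' s" by (rule qh[OF s])
  finally have "q * (m * r powr (- q) * s powr q) / s \<le> h' s" using r s by (simp add: field_simps)
  moreover have "s powr (q - 1) = s powr q / s" using r s by (simp add: powr_diff)
  ultimately show ?thesis by (simp add: q_def mult_ac)
qed

section \<open>Periodic extension\<close>

lemma periodic_shift_int:
  fixes f :: "real \<Rightarrow> 'a"
  assumes "\<And>t. f (t + T) = f t"
  shows "f (t + of_int k * T) = f t"
proof (induction k rule: int_induct[where k = 0])
  case base
  then show ?case by simp
next
  case (step1 i)
  then show ?case using assms[of "t + of_int i * T"] by (simp add: algebra_simps)
next
  case (step2 i)
  then show ?case using assms[of "t + of_int (i - 1) * T"] by (simp add: algebra_simps)
qed

text \<open>The integral equation is preserved by concatenation, restriction and shifts by whole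
  periods, so it spreads from \<open>[0,T]\<close> to every bounded interval;
  \<open>u T = u 0\<close> makes consecutive pieces fit.\<close>

lemma periodic_extension_solution:
  fixes F :: "real \<Rightarrow> real^2 \<Rightarrow> real^2"
  assumes T: "T > 0" and per: "\<And>t z. F (t + T) z = F t z"
    and sol: "integral_solution F 0 T u" and ai: "(\<lambda>t. F t (u t)) absolutely_integrable_on {0..T}"
    and uT: "u T = u 0"
  shows "\<exists>z. caratheodory_solution F UNIV z \<and> (\<forall>t. z (t + T) = z t)"
proof -
  define z where "z t = u (t - of_int \<lfloor>t / T\<rfloor> * T)" for t
  have zper: "z (t + T) = z t" for t
  proof -
    have "\<lfloor>(t + T) / T\<rfloor> = \<lfloor>t / T\<rfloor> + 1" using T by (simp add: add_divide_distrib)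
    then show ?thesis by (simp add: z_def algebra_simps)
  qed
  have zu: "z t = u t" if "t \<in> {0..T}" for t
  proof (cases "t = T")
    \<comment> \<open>At \<open>T\<close> the floor is already \<open>1\<close>, so \<open>z\<close>
      takes the value \<open>u 0\<close> there.\<close>
    case True
    then show ?thesis using T uT by (simp add: z_def)
  next
    case False
    then have "\<lfloor>t / T\<rfloor> = 0" using that T by (intro floor_unique) (auto simp: field_simps)
    then show ?thesis by (simp add: z_def)
  qed
  define g where "g t = F t (z t)" for t
  have gper: "g (t + T) = g t" for t by (simp add: g_def per zper)
  define Sol where "Sol a b \<longleftrightarrow> g absolutely_integrable_on {a..b} \<and> (g has_integral (z b - z a)) {a..b}" for a b
  have base: "Sol 0 t" if "t \<in> {0..T}" for t
    unfolding Sol_def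
  proof
    have "(\<lambda>t. F t (u t)) absolutely_integrable_on {0..t}"
      by (rule absolutely_integrable_on_subinterval[OF ai]) (use that in auto)
    then show "g absolutely_integrable_on {0..t}"
      by (rule absolutely_integrable_spike[where S = "{}"]) (use that zu in \<open>auto simp: g_def\<close>)
    have "((\<lambda>t. F t (u t)) has_integral (u t - u 0)) {0..t}" using sol that by (simp add: integral_solution_def)
    then have "(g has_integral (u t - u 0)) {0..t}"
      by (rule has_integral_spike[where S = "{}", rotated 2]) (use that zu in \<open>auto simp: g_def\<close>)
    then show "(g has_integral (z t - z 0)) {0..t}" using zu[OF that] zu[of 0] T by simp
  qed
  have comb: "Sol a c" if "Sol a b" "Sol b c" "a \<le> b" "b \<le> c" for a b c
    unfolding Sol_def
  proof
    show "g absolutely_integrable_on {a..c}"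
      by (rule absolutely_integrable_on_combine[where c = b]) (use that in \<open>simp_all add: Sol_def\<close>)
    have "(g has_integral (z b - z a) + (z c - z b)) {a..c}"
      by (rule has_integral_combine[of a b c]) (use that in \<open>simp_all add: Sol_def\<close>)
    then show "(g has_integral (z c - z a)) {a..c}" by simp
  qed
  have sub: "Sol b c" if "Sol a b" "Sol a c" "a \<le> b" "b \<le> c" for a b c
    unfolding Sol_def
  proof
    show "g absolutely_integrable_on {b..c}"
      by (rule absolutely_integrable_on_subinterval[where S = "{a..c}"]) (use that in \<open>auto simp: Sol_def\<close>)
    then have i: "g integrable_on {b..c}" by (simp add: absolutely_integrable_on_def)
    have "integral {a..b} g + integral {b..c} g = integral {a..c} g"
      by (rule Henstock_Kurzweil_Integration.integral_combine) (use that in \<open>auto simp: Sol_def\<close>)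
    then have "integral {b..c} g = z c - z b" using that by (auto simp: Sol_def integral_unique algebra_simps)
    then show "(g has_integral (z c - z b)) {b..c}" using integrable_integral[OF i] by simp
  qed
  have shift: "Sol (a + of_int k * T) (b + of_int k * T) \<longleftrightarrow> Sol a b" for a b k
  proof -
    have gk: "g \<circ> (+) (of_int k * T) = g"
      using periodic_shift_int[of g T, OF gper] by (simp add: fun_eq_iff add.commute)
    have ngk: "(\<lambda>t. norm (g t)) \<circ> (+) (of_int k * T) = (\<lambda>t. norm (g t))"
      using fun_cong[OF gk] by (simp add: fun_eq_iff)
    have zk: "z (t + of_int k * T) = z t" for t by (rule periodic_shift_int[of z T, OF zper])
    show ?thesis
      using integrable_on_shift_Icc_real[of g "of_int k * T" a b, unfolded gk]
        integrable_on_shift_Icc_real[of "\<lambda>t. norm (g t)" "of_int k * T" a b, unfolded ngk]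
        has_integral_shift_Icc_real[of g "of_int k * T" "z b - z a" a b, unfolded gk]
      by (simp add: Sol_def absolutely_integrable_on_def zk)
  qed
  have pos: "Sol 0 t" if "0 \<le> t" "t \<le> real n * T" for n t
    using that
  proof (induction n arbitrary: t)
    case 0
    then show ?case using base[of 0] T by simp
  next
    case (Suc n)
    show ?case
    proof (cases "t \<le> T")
      case True
      then show ?thesis using base Suc.prems by simp
    next
      case False
      then have "Sol 0 (t - T)" using Suc by (simp add: algebra_simps)
      then have "Sol T t" using shift[of 0 1 "t - T"] by simp
      then show ?thesis using comb[OF base[of T]] T False by simp
    qed
  qed
  have all: "Sol a b" if "a \<le> b" for a b
  proof -
    \<comment> \<open>A shift by \<open>n\<close> periods moves the interval to the right of
      \<open>0\<close>, where \<open>pos\<close> applies.\<close>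
    obtain n where n: "\<bar>a\<bar> / T \<le> real n" using real_arch_simple by blast
    define a' b' where "a' = a + of_int (int n) * T" and "b' = b + of_int (int n) * T"
    have "0 \<le> a'" using n T by (simp add: a'_def field_simps)
    have "a' \<le> b'" using that by (simp add: a'_def b'_def)
    obtain N where "b' / T \<le> real N" using real_arch_simple by blast
    then have N: "b' \<le> real N * T" using T by (simp add: field_simps)
    have "Sol a' b'"
      by (rule sub[OF pos[of a' N] pos[of b' N]]) (use \<open>0 \<le> a'\<close> \<open>a' \<le> b'\<close> N in auto)
    then show ?thesis using shift[of a "int n" b] by (simp add: a'_def b'_def)
  qed
  have "caratheodory_solution F UNIV z"
    by (rule integral_solution_imp_caratheodory_solution_UNIV)
      (use all in \<open>auto simp: integral_solution_def Sol_def g_def[abs_def]\<close>)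
  with zper show ?thesis by blast
qed

lemma solution_continuable_imp_exists:
  assumes "solution_continuable F S s z" "s \<in> S"
  shows "\<exists>v. caratheodory_solution F S v \<and> v s = z"
proof -
  have "caratheodory_solution F {s} (\<lambda>_. z)"
    unfolding caratheodory_solution_def
  proof (intro conjI allI impI)
    show "is_interval {s}" by (simp add: is_interval_1)
    show "abs_continuous_fun a b (\<lambda>_. z)" for a b
      unfolding abs_continuous_fun_def by (auto intro: exI[of _ 1])
    show "AE t in lebesgue. t \<in> {s} \<longrightarrow> ((\<lambda>_. z) has_vector_derivative F t z) (at t within {s})"
      unfolding eventually_ae_filter_negligible by (rule exI[of _ "{s}"]) auto
  qed
  then show ?thesis using assms unfolding solution_continuable_def by blast
qed

section \<open>From inequalities for the Hamiltonian to inequalities for its field, and the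
  conclusion\<close>

theorem theorem5p1:
  fixes T :: real and H :: "real \<Rightarrow> real^2 \<Rightarrow> real"
  assumes "T > 0"
    and H0_C1: "C1_in_space H"
    and H0_car: "caratheodory (hamiltonian_field H)"
    and H0_per: "\<forall>t z. hamiltonian_field H (t + T) z = hamiltonian_field H t z"
    and H0_uniq: "unique_solutions (hamiltonian_field H)"
    and H0_cont: "\<forall>s\<in>{0..T}. solution_continuable (hamiltonian_field H) {0..T} s 0"
    and H1: "\<exists>r c \<gamma>. r > 0 \<and> c > 0 \<and> \<gamma> \<ge> 1 \<and>
      (AE t in lebesgue. t \<in> {0..T} \<longrightarrow>
        (\<forall>\<theta>\<in>{0..<2*pi}. \<forall>\<rho>\<ge>r.
          deriv (\<lambda>\<rho>'. polar_H H t \<theta> \<rho>') \<rho>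
            \<ge> c * \<bar>deriv (\<lambda>\<theta>'. polar_H H t \<theta>' \<rho>) \<theta>\<bar> powr \<gamma>))"
    and H2: "\<exists>r k m. r > 0 \<and> 0 < k \<and> k < 1/2 \<and> m > 0 \<and>
      (AE t in lebesgue. t \<in> {0..T} \<longrightarrow>
        (\<forall>\<theta>\<in>{0..<2*pi}. \<forall>\<rho>\<ge>r.
          m \<le> polar_H H t \<theta> \<rho> \<and>
          polar_H H t \<theta> \<rho> \<le> 2 * k * \<rho> * deriv (\<lambda>\<rho>'. polar_H H t \<theta> \<rho>') \<rho>))"
  shows "\<exists>z. caratheodory_solution (hamiltonian_field H) UNIV z \<and> (\<forall>t. z (t + T) = z t)"
proof -
  let ?F = "hamiltonian_field H"
  have diff: "H t differentiable (at z)" for t z using H0_C1 by (simp add: C1_in_space_def)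
  have contF: "continuous_on UNIV (?F t)" for t
    unfolding hamiltonian_field_def
    by (rule continuous_on_compose2[OF linear_continuous_on[OF matrix_vector_mul_bounded_linear]])
      (use H0_C1 in \<open>auto simp: C1_in_space_def\<close>)
  interpret planar_field ?F T
    by unfold_locales (use assms contF in auto)
  have zero: "\<exists>v. caratheodory_solution ?F {0..T} v \<and> v s = 0" if "s \<in> {0..T}" for s
    using solution_continuable_imp_exists[OF H0_cont[rule_format, OF that] that] .
  have radius: "r \<le> (norm z)\<^sup>2 / 2" if "sqrt (2 * r) \<le> norm z" "r > 0" for r and z :: "real^2"
  proof -
    have "(sqrt (2 * r))\<^sup>2 \<le> (norm z)\<^sup>2" using that by (intro power_mono) auto
    then show ?thesis using that by simp
  qed
  obtain r1 c \<gamma> where r1: "r1 > 0" and c: "c > 0" and \<gamma>: "\<gamma> \<ge> 1"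
    and tw: "AE t in lebesgue. t \<in> {0..T} \<longrightarrow>
        (\<forall>\<theta>\<in>{0..<2*pi}. \<forall>\<rho>\<ge>r1.
          deriv (\<lambda>\<rho>'. polar_H H t \<theta> \<rho>') \<rho>
            \<ge> c * \<bar>deriv (\<lambda>\<theta>'. polar_H H t \<theta>' \<rho>) \<theta>\<bar> powr \<gamma>)"
    using H1 by blast
  \<comment> \<open>Since \<open>\<rho>\<close> is half the squared norm,
    \<open>r1 \<le> \<rho>\<close> becomes \<open>sqrt (2 * r1) \<le> norm z\<close>; every such
    \<open>z\<close> has a polar angle in \<open>{0..<2 * pi}\<close>.\<close>
  have twist: "AE t in lebesgue. t \<in> {0..T} \<longrightarrow> (\<forall>z. sqrt (2 * r1) \<le> norm z \<longrightarrow>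
      c * (\<bar>z \<bullet> ?F t z\<bar> - 1) \<le> (?F t z \<bullet> (symplectic_J *v z)) / (norm z)\<^sup>2)"
    using tw
  proof eventually_elim
    case (elim t)
    show ?case
    proof (intro impI allI)
      fix z :: "real^2" assume t: "t \<in> {0..T}" and z: "sqrt (2 * r1) \<le> norm z"
      define \<rho> where "\<rho> = (norm z)\<^sup>2 / 2"
      have \<rho>: "r1 \<le> \<rho>" using radius[OF z r1] by (simp add: \<rho>_def)
      then have "z \<noteq> 0" using r1 by (auto simp: \<rho>_def)
      then obtain \<theta> where \<theta>: "\<theta> \<in> {0..<2 * pi}" "polar \<theta> \<rho> = z" using polar_surj[of z] by (metis \<rho>_def)
      have "\<rho> > 0" using \<rho> r1 by simp
      note d = deriv_polar_H[of H t \<rho> \<theta>, OF diff this, unfolded \<theta>(2)]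
      have "c * (\<bar>z \<bullet> ?F t z\<bar> - 1) \<le> c * \<bar>z \<bullet> ?F t z\<bar> powr \<gamma>"
        using c \<gamma> by (intro mult_left_mono powr_ge_minus_one) auto
      also have "\<dots> \<le> deriv (\<lambda>\<rho>'. polar_H H t \<theta> \<rho>') \<rho>"
        using elim[rule_format, OF t \<theta>(1) \<rho>] by (simp add: d(2))
      also have "\<dots> = (?F t z \<bullet> (symplectic_J *v z)) / (norm z)\<^sup>2"
        by (rule DERIV_imp_deriv[OF d(1)])
      finally show "c * (\<bar>z \<bullet> ?F t z\<bar> - 1) \<le> (?F t z \<bullet> (symplectic_J *v z)) / (norm z)\<^sup>2" .
    qed
  qed
  obtain r2 k m where r2: "r2 > 0" and k: "0 < k" "k < 1/2" and m: "m > 0"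
    and sq: "AE t in lebesgue. t \<in> {0..T} \<longrightarrow>
        (\<forall>\<theta>\<in>{0..<2*pi}. \<forall>\<rho>\<ge>r2.
          m \<le> polar_H H t \<theta> \<rho> \<and>
          polar_H H t \<theta> \<rho> \<le> 2 * k * \<rho> * deriv (\<lambda>\<rho>'. polar_H H t \<theta> \<rho>') \<rho>)"
    using H2 by blast
  have superlinear: "\<exists>R. AE t in lebesgue. t \<in> {0..T} \<longrightarrow> (\<forall>z. R \<le> norm z \<longrightarrow>
      B \<le> (?F t z \<bullet> (symplectic_J *v z)) / (norm z)\<^sup>2)" for B
  proof -
    define C where "C = m * r2 powr (- (1 / (2 * k))) / (2 * k)"
    have C: "C > 0" using m r2 k by (simp add: C_def)
    \<comment> \<open>The exponent is positive because \<open>k < 1/2\<close>; this makes the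
      angular speed unbounded.\<close>
    define p where "p = 1 / (2 * k) - 1"
    have p: "p > 0" using k by (simp add: p_def field_simps)
    \<comment> \<open>Chosen to give \<open>B / C \<le> X powr p\<close>; the maximum with
      \<open>1\<close> keeps the base positive for every \<open>B\<close>.\<close>
    define X where "X = max (B / C) 1 powr (1 / p)"
    have X: "B / C \<le> s powr p" if "X \<le> s" for s
    proof -
      have "B / C \<le> X powr p" using p by (simp add: X_def powr_powr)
      also have "\<dots> \<le> s powr p" using p that by (intro powr_mono2) (auto simp: X_def)
      finally show ?thesis .
    qed
    define X' where "X' = max X r2"
    have X': "X' > 0" "X \<le> X'" "r2 \<le> X'" using r2 by (auto simp: X'_def)
    show ?thesis
    proof (rule exI[of _ "sqrt (2 * X')"], use sq in eventually_elim, intro impI allI)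
      fix t and z :: "real^2"
      assume el: "t \<in> {0..T} \<longrightarrow> (\<forall>\<theta>\<in>{0..<2*pi}. \<forall>\<rho>\<ge>r2.
          m \<le> polar_H H t \<theta> \<rho> \<and>
          polar_H H t \<theta> \<rho> \<le> 2 * k * \<rho> * deriv (\<lambda>\<rho>'. polar_H H t \<theta> \<rho>') \<rho>)"
        and t: "t \<in> {0..T}" and z: "sqrt (2 * X') \<le> norm z"
      define \<rho> where "\<rho> = (norm z)\<^sup>2 / 2"
      have \<rho>: "X' \<le> \<rho>" using radius[OF z X'(1)] by (simp add: \<rho>_def)
      then have "z \<noteq> 0" using X' by (auto simp: \<rho>_def)
      then obtain \<theta> where \<theta>: "\<theta> \<in> {0..<2 * pi}" "polar \<theta> \<rho> = z" using polar_surj[of z] by (metis \<rho>_def)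
      have \<rho>0: "\<rho> > 0" using \<rho> X' by simp
      \<comment> \<open>Growth cannot be read off at \<open>z\<close> alone: (H2) is used along the
        whole ray with this angle, from \<open>r2\<close> on.\<close>
      have bd: "m \<le> polar_H H t \<theta> s" "polar_H H t \<theta> s \<le> 2 * k * s * deriv (\<lambda>\<rho>'. polar_H H t \<theta> \<rho>') s"
        if "r2 \<le> s" for s using el t \<theta>(1) that by blast+
      have dd: "((\<lambda>\<rho>'. polar_H H t \<theta> \<rho>') has_real_derivative deriv (\<lambda>\<rho>'. polar_H H t \<theta> \<rho>') s) (at s)" if "r2 \<le> s" for s
        using deriv_polar_H(1)[of H t s \<theta>, OF diff] that r2 DERIV_imp_deriv by fastforce
      have "B = C * (B / C)" using C by simp
      also have "\<dots> \<le> C * \<rho> powr p" using C X[of \<rho>] \<rho> X' by (intro mult_left_mono) auto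
      also have "\<dots> \<le> deriv (\<lambda>\<rho>'. polar_H H t \<theta> \<rho>') \<rho>"
        unfolding C_def p_def by (rule superquadratic_growth[OF r2 k(1) m dd bd]) (use \<rho> X' in auto)
      also have "\<dots> = (?F t z \<bullet> (symplectic_J *v z)) / (norm z)\<^sup>2"
        by (rule DERIV_imp_deriv[OF deriv_polar_H(1)[of H t \<rho> \<theta>, OF diff \<rho>0, unfolded \<theta>(2)]])
      finally show "B \<le> (?F t z \<bullet> (symplectic_J *v z)) / (norm z)\<^sup>2" .
    qed
  qed
  obtain R u where R: "R \<ge> 0" and u: "integral_solution (truncated R) 0 T u"
    "\<And>t. t \<in> {0..T} \<Longrightarrow> norm (u t) \<le> R" "u T = u 0"
    using truncated_periodic_solution[OF zero c _ twist superlinear] r1 by (metis mult_pos_pos real_sqrt_gt_zero zero_less_numeral)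
  \<comment> \<open>The solution stays in the closed ball, where truncated and original field agree
    at almost every time of \<open>[0,T]\<close>, so it solves the original equation.\<close>
  show ?thesis
  proof (rule periodic_extension_solution[OF \<open>T > 0\<close>])
    show "?F (t + T) z = ?F t z" for t z using H0_per by blast
    show "integral_solution ?F 0 T u" "(\<lambda>t. ?F t (u t)) absolutely_integrable_on {0..T}"
      using truncated_transfer[OF u(1) R order_refl order_refl negligible_empty u(2)] by auto
  qed (fact u(3))
qed

end
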